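(* As formal power series in $q$ (writing $R_i=R_i(q)$, $S=S(q)$, $T=T(q)$): \begin{align*} \sum_{n\geq 0} M_{\omega}(0,5,n)q^n =&\tfrac{q^3}{5} D(q^5)(-3R_1+2R_2+2R_3-3R_4+2R_5-2S)+\tfrac{q^2}{5} C(q^5)(-2R_1+3R_2+3R_3-2R_4-2R_5+2S)\\ &+\tfrac{q}{5} B(q^5)(4R_1-R_2-R_3+4R_4-6R_5+6S)+\tfrac{1}{5} A(q^5)(-R_1-R_2-R_3-R_4+4R_5-4S)+T,\\ \sum_{n\geq 0} M_{\omega}(1,5,n)q^n =&\tfrac{q^3}{5} D(q^5)(2R_1+2R_2-3R_3+2R_4-3R_5+3S)+\tfrac{q^2}{5} C(q^5)(3R_1+3R_2-2R_3-2R_4-2R_5+2S)\\ &+\tfrac{q}{5} B(q^5)(-R_1-R_2+4R_3-6R_4+4R_5-4S)+\tfrac{1}{5} A(q^5)(-R_1-R_2-R_3+4R_4-R_5+S)+T,\\ \sum_{n\geq 0} M_{\omega}(2,5,n)q^n =&\tfrac{q^3}{5} D(q^5)(2R_1-3R_2+2R_3-3R_4+2R_5-2S)+\tfrac{q^2}{5} C(q^5)(3R_1-2R_2-2R_3-2R_4+3R_5-3S)\\ &+\tfrac{q}{5} B(q^5)(-R_1+4R_2-6R_3+4R_4-R_5+S)+\tfrac{1}{5} A(q^5)(-R_1-R_2+4R_3-R_4-R_5+S)+T,\\ \sum_{n\geq 0} M_{\omega}(3,5,n)q^n =&\tfrac{q^3}{5} D(q^5)(-3R_1+2R_2-3R_3+2R_4+2R_5-2S)+\tfrac{q^2}{5}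 C(q^5)(-2R_1-2R_2-2R_3+3R_4+3R_5-3S)\\ &+\tfrac{q}{5} B(q^5)(4R_1-6R_2+4R_3-R_4-R_5+S)+\tfrac{1}{5} A(q^5)(-R_1+4R_2-R_3-R_4-R_5+S)+T,\\ \sum_{n\geq 0} M_{\omega}(4,5,n)q^n =&\tfrac{q^3}{5} D(q^5)(2R_1-3R_2+2R_3+2R_4-3R_5+3S)+\tfrac{q^2}{5} C(q^5)(-2R_1-2R_2+3R_3+3R_4-2R_5+2S)\\ &+\tfrac{q}{5} B(q^5)(-6R_1+4R_2-R_3-R_4+4R_5-4S)+\tfrac{1}{5} A(q^5)(4R_1-R_2-R_3-R_4-R_5+S)+T. \end{align*}
   Context: For a partition $\pi$ of a positive integer $n$ (written $\pi\vdash n$), let $\lambda(\pi)$ be the largest part, $\omega(\pi)$ the number of parts equal to $1$, and $\mu(\pi)$ the number of parts larger than $\omega(\pi)$. The crank is $\mathrm{crank}(\pi)=\lambda(\pi)$ if $\omega(\pi)=0$ and $\mathrm{crank}(\pi)=\mu(\pi)-\omega(\pi)$ otherwise. For integers $m$, $j\ge1$, $n\ge0$: $M_{\omega}(m,j,n)=\sum_{\pi\vdash n,\ \mathrm{crank}(\pi)\equiv m\ (\mathrm{mod}\ j)}\omega(\pi)$ (so $M_\omega(m,j,0)=0$). Notation: $(a;q)_\infty=\prod_{k\ge0}(1-aq^k)$ and $(a_1,\dots,a_k;q)_\infty=(a_1;q)_\infty\cdots(a_k;q)_\infty$. Define $A(q)=\frac{(q^2,q^3,q^5;q^5)_\infty}{(q,q^4;q^5)_\infty^2}$,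 $B(q)=\frac{(q^5;q^5)_\infty}{(q,q^4;q^5)_\infty}$, $C(q)=\frac{(q^5;q^5)_\infty}{(q^2,q^3;q^5)_\infty}$, $D(q)=\frac{(q,q^4,q^5;q^5)_\infty}{(q^2,q^3;q^5)_\infty^2}$, and $R_i(q)=\sum_{n=1}^\infty \frac{q^{ni}}{1-q^{5n}}$ for $i=1,\dots,5$, $S(q)=\sum_{n=1}^\infty\frac{q^{n+1}}{1-q^{n+1}}$, $T(q)=\frac{q}{5(1-q)(q;q)_\infty}$. *)

theory Defs
  imports
    "HOL-Analysis.Analysis"
    "HOL-Library.Multiset"
    "HOL-Number_Theory.Cong"
    "HOL-Computational_Algebra.Formal_Power_Series"
begin

definition partitions_of :: "nat \<Rightarrow> nat multiset set" where
  "partitions_of n = {\<pi>. 0 \<notin># \<pi> \<and> sum_mset \<pi> = n}"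

lemma finite_partitions_of: "finite (partitions_of n)"
proof -
  have size_le: "size \<pi> \<le> sum_mset \<pi>" if "0 \<notin># \<pi>" for \<pi> :: "nat multiset"
    using that by (induction \<pi>) (auto simp: Suc_le_eq)
  have mem_le: "x \<le> sum_mset \<pi>" if "x \<in># \<pi>" for x and \<pi> :: "nat multiset"
    using that by (metis insert_DiffM le_add1 sum_mset.add_mset)
  have "partitions_of n \<subseteq> mset ` {xs. set xs \<subseteq> {..n} \<and> length xs \<le> n}"
  proof
    fix \<pi> assume "\<pi> \<in> partitions_of n"
    hence p: "0 \<notin># \<pi>" "sum_mset \<pi> = n"
      by (auto simp: partitions_of_def)
    obtain xs where xs: "mset xs = \<pi>"
      using ex_mset by blast
    have "length xs \<le> n"
      using size_le[OF p(1)] p(2) xs size_mset[of xs] by simp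
    moreover have "set xs \<subseteq> {..n}"
      using mem_le[of _ \<pi>] p(2) xs set_mset_mset[of xs] by auto
    ultimately show "\<pi> \<in> mset ` {xs. set xs \<subseteq> {..n} \<and> length xs \<le> n}"
      using xs by auto
  qed
  thus ?thesis
    using finite_lists_length_le[of "{..n}" n] finite_subset by blast
qed

definition largest_part :: "nat multiset \<Rightarrow> nat" where
  "largest_part \<pi> = Max (set_mset \<pi>)"

definition ones :: "nat multiset \<Rightarrow> nat" where
  "ones \<pi> = count \<pi> 1"

text \<open>Parts are counted with multiplicity.\<close>
definition mu :: "nat multiset \<Rightarrow> nat" where
  "mu \<pi> = size {#x \<in># \<pi>. x > ones \<pi>#}"

text \<open>The value at the empty multiset is meaningless; it is multiplied by
  \<open>ones {#} = 0\<close> in \<open>M_omega\<close>.\<close>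
definition crank :: "nat multiset \<Rightarrow> int" where
  "crank \<pi> =
     (if ones \<pi> = 0 then int (largest_part \<pi>) else int (mu \<pi>) - int (ones \<pi>))"

definition M_omega :: "int \<Rightarrow> nat \<Rightarrow> nat \<Rightarrow> nat" where
  "M_omega m j n = (\<Sum>\<pi> | \<pi> \<in> partitions_of n \<and> [crank \<pi> = m] (mod int j). ones \<pi>)"

text \<open>
  A series \<open>F(q)\<close> is rendered as a function of a formal power series \<open>q\<close> with zero
  constant term, so that \<open>F(q^5)\<close> is the value at \<open>fps_X ^ 5\<close>. Infinite sums and products
  are the library's limits in the \<open>X\<close>-adic metric on formal power series. All divisors
  have nonzero constant term, so the divisions are multiplications by inverses.
\<close>

definition qpoch_inf :: "complex fps \<Rightarrow> complex fps \<Rightarrow> complex fps" where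
  "qpoch_inf a q = (\<Prod>k. 1 - a * q ^ k)"

definition qpochs_inf :: "complex fps list \<Rightarrow> complex fps \<Rightarrow> complex fps" where
  "qpochs_inf as q = (\<Prod>a\<leftarrow>as. qpoch_inf a q)"

definition A_ser :: "complex fps \<Rightarrow> complex fps" where
  "A_ser q = qpochs_inf [q^2, q^3, q^5] (q^5) / (qpochs_inf [q, q^4] (q^5))^2"

definition B_ser :: "complex fps \<Rightarrow> complex fps" where
  "B_ser q = qpoch_inf (q^5) (q^5) / qpochs_inf [q, q^4] (q^5)"

definition C_ser :: "complex fps \<Rightarrow> complex fps" where
  "C_ser q = qpoch_inf (q^5) (q^5) / qpochs_inf [q^2, q^3] (q^5)"

definition D_ser :: "complex fps \<Rightarrow> complex fps" where
  "D_ser q = qpochs_inf [q, q^4, q^5] (q^5) / (qpochs_inf [q^2, q^3] (q^5))^2"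

text \<open>The sums over \<open>n \<ge> 1\<close> are shifted to start at \<open>0\<close>.\<close>
definition R_ser :: "nat \<Rightarrow> complex fps \<Rightarrow> complex fps" where
  "R_ser i q = (\<Sum>n. q ^ (Suc n * i) / (1 - q ^ (5 * Suc n)))"

definition S_ser :: "complex fps \<Rightarrow> complex fps" where
  "S_ser q = (\<Sum>n. q ^ (Suc n + 1) / (1 - q ^ (Suc n + 1)))"

definition T_ser :: "complex fps \<Rightarrow> complex fps" where
  "T_ser q = q / (5 * (1 - q) * qpoch_inf q q)"

definition M_omega_gf :: "int \<Rightarrow> nat \<Rightarrow> complex fps" where
  "M_omega_gf m j = Abs_fps (\<lambda>n. of_nat (M_omega m j n))"

end

(*
  Sorting partitions by their number j of ones and applying the logarithmic derivative of the
  q-binomial theorem gives, for every nonzero z,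

    sum_pi omega(pi) z^crank(pi) q^|pi|
      = (q;q) / ((zq;q) (q/z;q)) * (sum_{n >= 1} (q^n/z) / (1 - q^n/z) - S).

  At a primitive fifth root of unity z the last sum is sum_i z^(-i) R_i, and the product is
  5-dissected as follows. By the Jacobi triple product, f(z) = (q;q)(zq;q)(q/z;q) equals
  E (P' + (z^2 + z^(-2)) q P) with E = (q^25;q^25), P = (q^5,q^20;q^25), P' = (q^10,q^15;q^25).
  Since the product of all (z^r q;q) is (q^5;q^5) = E P P', the wanted quotient is
  f(z^2)^2 f(z) / (E P P')^2, and expanding this cube yields A, B, C, D.
  The value z = 1 gives 5 T. Inverting the discrete Fourier transform over the fifth roots of
  unity separates the residue classes.
*)
theory Submission
  imports Defs
begin

text \<open>All identities live in \<open>complex fps\<close>, where z is a constant series and q =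
  \<open>fps_X\<close> has no inverse. The triple product is therefore stated for two arguments a, b
  with base a * b, and is used at a = z, b = z^4 q. This brings in an extra factor 1 - z, a nonzero
  constant that cancels later. Since a is then a unit, convergence has to come from a * b alone.
  Limits are controlled by congruences modulo q^N, which turn infinite sums and products into finite
  ones. The weight of a part depends on the number j of ones, so no single product enumerates all
  partitions. For fixed j there is one, and its dependence on j reduces to (zq;q)_j / (q;q)_j, the
  coefficient of the q-binomial series. The weight omega contributes the factor j, and hence a
  derivative of that series. Because 1 + z + z^2 + z^3 + z^4 = 0, the coefficients of the powers of
  z cannot be compared directly: the values at the nontrivial roots fix the five classes only up to
  one common series. The total, taken from z = 1, determines it.\<close>

unbundle no vec_syntax
unbundle fps_syntax

section \<open>Limits and congruences of formal power series\<close>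

lemma tendsto_add_fps:
  fixes f g :: "'b \<Rightarrow> 'a::ab_group_add fps"
  assumes "(f \<longlongrightarrow> a) F" "(g \<longlongrightarrow> b) F"
  shows "((\<lambda>x. f x + g x) \<longlongrightarrow> a + b) F"
proof (rule tendsto_fpsI)
  fix n
  have "eventually (\<lambda>x. f x $ n = a $ n) F" "eventually (\<lambda>x. g x $ n = b $ n) F"
    using assms unfolding tendsto_fps_iff by blast+
  thus "eventually (\<lambda>x. (f x + g x) $ n = (a + b) $ n) F"
    by eventually_elim simp
qed

lemma tendsto_diff_fps:
  fixes f g :: "'b \<Rightarrow> 'a::ab_group_add fps"
  assumes "(f \<longlongrightarrow> a) F" "(g \<longlongrightarrow> b) F"
  shows "((\<lambda>x. f x - g x) \<longlongrightarrow> a - b) F"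
proof (rule tendsto_fpsI)
  fix n
  have "eventually (\<lambda>x. f x $ n = a $ n) F" "eventually (\<lambda>x. g x $ n = b $ n) F"
    using assms unfolding tendsto_fps_iff by blast+
  thus "eventually (\<lambda>x. (f x - g x) $ n = (a - b) $ n) F"
    by eventually_elim simp
qed

lemma tendsto_mult_fps:
  fixes f g :: "'b \<Rightarrow> 'a::comm_ring_1 fps"
  assumes "(f \<longlongrightarrow> a) F" "(g \<longlongrightarrow> b) F"
  shows "((\<lambda>x. f x * g x) \<longlongrightarrow> a * b) F"
proof (rule tendsto_fpsI)
  fix n
  have "eventually (\<lambda>x. \<forall>i\<in>{..n}. f x $ i = a $ i) F" "eventually (\<lambda>x. \<forall>i\<in>{..n}. g x $ i = b $ i) F"
    using assms unfolding tendsto_fps_iff by (auto intro!: eventually_ball_finite)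
  thus "eventually (\<lambda>x. (f x * g x) $ n = (a * b) $ n) F"
    by eventually_elim (simp add: fps_mult_nth)
qed

section \<open>Congruences modulo a power of X\<close>

lemma fps_X_power_dvd_iff: "fps_X ^ N dvd (f :: 'a::field fps) \<longleftrightarrow> (\<forall>i<N. f $ i = 0)"
proof
  assume "fps_X ^ N dvd f" thus "\<forall>i<N. f $ i = 0" by (auto simp: dvd_def fps_X_power_mult_nth)
next
  assume "\<forall>i<N. f $ i = 0"
  hence "f = fps_X ^ N * fps_shift N f" by (auto simp: fps_eq_iff fps_X_power_mult_nth)
  thus "fps_X ^ N dvd f" by (metis dvd_triv_left)
qed


definition fps_cong :: "nat \<Rightarrow> 'a::field fps \<Rightarrow> 'a fps \<Rightarrow> bool" where
  "fps_cong N f g \<longleftrightarrow> fps_X ^ N dvd f - g"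

lemma fps_cong_iff: "fps_cong N f g \<longleftrightarrow> (\<forall>i<N. f $ i = g $ i)"
  by (simp add: fps_cong_def fps_X_power_dvd_iff)

lemma fps_cong_refl [simp, intro]: "fps_cong N f f"
  by (simp add: fps_cong_iff)

lemma fps_cong_sym: "fps_cong N f g \<Longrightarrow> fps_cong N g f"
  by (simp add: fps_cong_iff)

lemma fps_cong_trans [trans]: "fps_cong N f g \<Longrightarrow> fps_cong N g h \<Longrightarrow> fps_cong N f h"
  by (simp add: fps_cong_iff)

lemma fps_cong_add: "fps_cong N f g \<Longrightarrow> fps_cong N f' g' \<Longrightarrow> fps_cong N (f + f') (g + g')"
  by (simp add: fps_cong_iff)

lemma fps_cong_diff: "fps_cong N f g \<Longrightarrow> fps_cong N f' g' \<Longrightarrow> fps_cong N (f - f') (g - g')"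
  by (simp add: fps_cong_iff)

lemma fps_cong_mult: "fps_cong N f g \<Longrightarrow> fps_cong N f' g' \<Longrightarrow> fps_cong N (f * f') (g * g')"
  by (auto simp: fps_cong_iff fps_mult_nth)

lemma fps_cong_sum: "(\<And>x. x \<in> A \<Longrightarrow> fps_cong N (f x) (g x)) \<Longrightarrow> fps_cong N (sum f A) (sum g A)"
  by (auto simp: fps_cong_iff fps_sum_nth)

lemma fps_cong_inverse:
  assumes "fps_cong N f g" "f $ 0 \<noteq> 0" "g $ 0 \<noteq> 0"
  shows "fps_cong N (inverse f) (inverse g)"
proof -
  have "inverse f - inverse g = (f - g) * (- inverse f * inverse g)"
    using inverse_mult_eq_1[OF assms(2)] inverse_mult_eq_1[OF assms(3)] by algebra
  with assms(1) show ?thesis by (simp add: fps_cong_def)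
qed

lemma fps_cong_0_iff: "fps_cong N f 0 \<longleftrightarrow> fps_X ^ N dvd f"
  by (simp add: fps_cong_def)

lemma fps_cong_mono: "fps_cong N f g \<Longrightarrow> M \<le> N \<Longrightarrow> fps_cong M f g"
  by (simp add: fps_cong_iff)

lemma fps_nth_0_iff_dvd: "f $ 0 = 0 \<longleftrightarrow> fps_X dvd (f :: 'a::field fps)"
  using fps_X_power_dvd_iff[of 1 f] by simp

lemma fps_X_power_dvd_power: "f $ 0 = 0 \<Longrightarrow> fps_X ^ n dvd (f :: 'a::field fps) ^ n"
  by (simp add: fps_nth_0_iff_dvd dvd_power_same)

lemma tendsto_fps_congI:
  fixes F G :: "nat \<Rightarrow> 'a::field fps"
  assumes "\<And>N. eventually (\<lambda>n. fps_cong N (F n) (G n)) sequentially" "G \<longlonglongrightarrow> L"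
  shows "F \<longlonglongrightarrow> L"
proof (rule tendsto_fpsI)
  fix n
  have "eventually (\<lambda>x. G x $ n = L $ n) sequentially"
    using assms(2) unfolding tendsto_fps_iff by blast
  with assms(1)[of "Suc n"] show "eventually (\<lambda>x. F x $ n = L $ n) sequentially"
    by eventually_elim (simp add: fps_cong_iff)
qed

text \<open>Stability modulo \<open>fps_X ^ n\<close> fixes only the coefficients below
  \<open>n\<close>, so coefficient \<open>n\<close> is final from index \<open>Suc n\<close> on;
  hence the diagonal in \<open>L\<close>.\<close>

lemma stable_fps_limit:
  fixes F :: "nat \<Rightarrow> 'a::field fps"
  assumes "\<And>n. fps_cong n (F (Suc n)) (F n)"
  defines "L \<equiv> Abs_fps (\<lambda>n. F (Suc n) $ n)"
  shows "\<And>N n. N \<le> n \<Longrightarrow> fps_cong N (F n) L" "F \<longlonglongrightarrow> L"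
proof -
  have *: "fps_cong m (F n) (F m)" if "m \<le> n" for m n
    using that
  proof (induction n rule: dec_induct)
    case (step n)
    have "fps_cong m (F (Suc n)) (F n)" using assms(1) step.hyps by (auto intro: fps_cong_mono)
    thus ?case using step.IH fps_cong_trans by blast
  qed simp
  show **: "fps_cong N (F n) L" if "N \<le> n" for n N
    unfolding L_def fps_cong_iff
  proof (intro allI impI)
    fix i assume "i < N"
    thus "F n $ i = Abs_fps (\<lambda>n. F (Suc n) $ n) $ i"
      using *[of "Suc i" n] that by (simp add: fps_cong_iff)
  qed
  have "F \<longlonglongrightarrow> L"
  proof (rule tendsto_fpsI)
    fix k show "eventually (\<lambda>n. F n $ k = L $ k) sequentially"
      using eventually_ge_at_top[of "Suc k"] by eventually_elim (use ** in \<open>auto simp: fps_cong_iff\<close>)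
  qed
  thus "F \<longlonglongrightarrow> L" .
qed

lemma sums_fps:
  fixes f :: "nat \<Rightarrow> 'a::field fps"
  assumes "\<And>n. fps_X ^ n dvd f n"
  shows "(\<lambda>n. \<Sum>k<n. f k) \<longlonglongrightarrow> suminf f"
proof -
  have "fps_cong n (\<Sum>k<Suc n. f k) (\<Sum>k<n. f k)" for n
    using assms by (simp add: fps_cong_def)
  from stable_fps_limit(2)[of "\<lambda>n. \<Sum>k<n. f k", OF this] have "summable f"
    unfolding summable_def sums_def by blast
  thus ?thesis using summable_LIMSEQ by blast
qed

section \<open>Finite q-Pochhammer symbols and their limits\<close>

definition qpoch :: "'a::comm_ring_1 \<Rightarrow> 'a \<Rightarrow> nat \<Rightarrow> 'a" where
  "qpoch a q n = (\<Prod>k<n. 1 - a * q ^ k)"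

lemma qpoch_0 [simp]: "qpoch a q 0 = 1"
  by (simp add: qpoch_def)

lemma qpoch_Suc: "qpoch a q (Suc n) = qpoch a q n * (1 - a * q ^ n)"
  by (simp add: qpoch_def)

lemma qpoch_add: "qpoch a q (m + n) = qpoch a q m * qpoch (a * q ^ m) q n"
  by (induction n) (simp_all add: qpoch_Suc power_add mult_ac)

lemma qpoch_Suc_left: "qpoch a q (Suc n) = (1 - a) * qpoch (a * q) q n"
  using qpoch_add[of a q 1 n] by (simp add: qpoch_Suc)

lemma qpoch_fps_nth_0:
  fixes q :: "'a::field fps"
  assumes "q $ 0 = 0"
  shows "qpoch a q n $ 0 = (if n = 0 then 1 else 1 - a $ 0)"
  by (induction n) (auto simp: qpoch_Suc assms fps_nth_power_0)

lemma qpoch_fps_cong: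
  fixes q :: "'a::field fps"
  assumes "q $ 0 = 0"
  shows "fps_cong n (qpoch a q (Suc n)) (qpoch a q n)"
proof -
  have "qpoch a q (Suc n) - qpoch a q n = - (a * qpoch a q n) * q ^ n"
    by (simp add: qpoch_Suc algebra_simps)
  thus ?thesis using fps_X_power_dvd_power[OF assms] by (simp add: fps_cong_def)
qed

text \<open>All factors after the first have constant term 1, so the limit has constant term
  \<open>1 - a $ 0\<close>. A value other than 0 there makes the limit nonzero, which is what
  \<open>raw_has_prod\<close> demands of partial products.\<close>

lemma qpoch_tendsto:
  assumes "q $ 0 = 0" "a $ 0 \<noteq> 1"
  shows "qpoch a q \<longlonglongrightarrow> qpoch_inf a q" and "qpoch_inf a q $ 0 = 1 - a $ 0"
    and "fps_cong n (qpoch a q n) (qpoch_inf a q)"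
proof -
  define L where "L = Abs_fps (\<lambda>n. qpoch a q (Suc n) $ n)"
  have L: "qpoch a q \<longlonglongrightarrow> L" unfolding L_def
    by (rule stable_fps_limit(2)) (rule qpoch_fps_cong[OF assms(1)])
  have L0: "L $ 0 = 1 - a $ 0" by (simp add: L_def qpoch_fps_nth_0 assms)
  hence "L \<noteq> 0" using assms by auto
  moreover have "(\<lambda>n. \<Prod>k\<le>n. 1 - a * q ^ k) \<longlonglongrightarrow> L"
    using LIMSEQ_Suc[OF L] by (simp add: qpoch_def lessThan_Suc_atMost)
  ultimately have "(\<lambda>k. 1 - a * q ^ k) has_prod L"
    by (simp add: has_prod_def raw_has_prod_def)
  hence "qpoch_inf a q = L" unfolding qpoch_inf_def using has_prod_unique by metis
  moreover have "fps_cong n (qpoch a q n) L" unfolding L_def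
    by (rule stable_fps_limit(1)) (use qpoch_fps_cong[OF assms(1)] in simp_all)
  ultimately show "qpoch a q \<longlonglongrightarrow> qpoch_inf a q" "qpoch_inf a q $ 0 = 1 - a $ 0"
    "fps_cong n (qpoch a q n) (qpoch_inf a q)" using L L0 by simp_all
qed

section \<open>The Jacobi triple product\<close>

text \<open>The value \<open>0\<close> at negative indices makes \<open>qpascal\<close> hold at the boundary of the triangle as well.\<close>
definition inv_qfact :: "'a::field fps \<Rightarrow> int \<Rightarrow> 'a fps" where
  "inv_qfact q i = (if i < 0 then 0 else inverse (qpoch q q (nat i)))"

lemma inv_qfact_pred:
  assumes "q $ 0 = 0" "i \<ge> 0"
  shows "inv_qfact q (i - 1) = (1 - q ^ nat i) * inv_qfact q i"
proof (cases "i = 0")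
  case False
  then obtain n where i: "i = int (Suc n)" using assms(2)
    by (metis nonneg_int_cases not0_implies_Suc of_nat_0)
  have "qpoch q q (Suc n) = (1 - q ^ Suc n) * qpoch q q n" by (simp add: qpoch_Suc)
  hence "inv_qfact q i = inverse (1 - q ^ Suc n) * inverse (qpoch q q n)"
    unfolding inv_qfact_def i nat_int by (simp add: fps_inverse_mult)
  moreover have "(1 - q ^ Suc n) * inverse (1 - q ^ Suc n) = 1"
    by (rule inverse_mult_eq_1') (simp add: assms)
  moreover have "inv_qfact q (i - 1) = inverse (qpoch q q n)" "nat i = Suc n"
    by (simp_all add: inv_qfact_def i)
  ultimately show ?thesis by (simp add: mult.assoc [symmetric])
qed (simp add: inv_qfact_def)

text \<open>The q-Pascal rule with the numerator factorials cleared. With r = q^i and s = q^j it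
  reduces to (1 - s) + s (1 - r) = 1 - r s.\<close>

lemma qpascal:
  assumes "q $ 0 = 0" "i \<ge> 0" "j \<ge> 0"
  shows "inv_qfact q i * inv_qfact q (j - 1) + q ^ nat j * inv_qfact q (i - 1) * inv_qfact q j =
    (1 - q ^ nat (i + j)) * inv_qfact q i * inv_qfact q j"
proof -
  have "q ^ nat (i + j) = q ^ nat i * q ^ nat j"
    using assms by (simp add: nat_add_distrib power_add)
  moreover have "x * ((1 - s) * y) + s * ((1 - r) * x) * y = (1 - r * s) * x * y" for r s x y :: "'a fps"
    by (simp add: algebra_simps)
  ultimately show ?thesis
    by (simp only: inv_qfact_pred[OF assms(1,2)] inv_qfact_pred[OF assms(1,3)])
qed

text \<open>With \<open>q = a * b\<close> this is \<open>(-1)^k a^k q^(k(k-1)/2)\<close>; the symmetric form avoids negative powers of \<open>a\<close>.\<close>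
definition theta_term :: "'a::comm_ring_1 \<Rightarrow> 'a \<Rightarrow> int \<Rightarrow> 'a" where
  "theta_term a b k = (- 1) ^ nat \<bar>k\<bar> * a ^ nat (k * (k + 1) div 2) * b ^ nat (k * (k - 1) div 2)"

lemma theta_term_swap: "theta_term b a (- k) = theta_term a b k"
proof -
  have "- k * (- k + 1) = k * (k - 1)" "- k * (- k - 1) = k * (k + 1)"
    by (simp_all add: algebra_simps)
  thus ?thesis by (simp only: theta_term_def abs_minus_cancel mult_ac)
qed

lemma triangle_nonneg: "k * (k + 1) div 2 \<ge> (0::int)" "k * (k - 1) div 2 \<ge> (0::int)"
proof -
  have "k * (k + 1) \<ge> 0" by (cases "k \<ge> 0") (auto intro: mult_nonpos_nonpos)
  thus "k * (k + 1) div 2 \<ge> 0" by simp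
  have "k * (k - 1) \<ge> 0" by (cases "k \<ge> 1") (auto intro: mult_nonpos_nonpos)
  thus "k * (k - 1) div 2 \<ge> 0" by simp
qed

lemma triangle_step: "k * (k + 1) div 2 = (k - 1) * k div 2 + (k :: int)"
proof -
  have "k * (k + 1) = (k - 1) * k + k * 2" by (simp add: algebra_simps)
  thus ?thesis by simp
qed

text \<open>Consecutive terms have the ratio - a (a b)^(k - 1). Multiplying by (a b)^(n + 1 - k)
  keeps every exponent nonnegative for all k \<le> n + 1, including negative k.\<close>

lemma theta_term_step:
  assumes "k \<le> int n + 1"
  shows "a * (a * b) ^ n * theta_term a b (k - 1) = - ((a * b) ^ nat (int n + 1 - k) * theta_term a b k)"
proof -
  have s: "(- 1 :: 'a) ^ nat \<bar>k\<bar> = - ((- 1) ^ nat \<bar>k - 1\<bar> :: 'a)"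
  proof -
    have "nat \<bar>k\<bar> = Suc (nat \<bar>k - 1\<bar>) \<or> nat \<bar>k - 1\<bar> = Suc (nat \<bar>k\<bar>)" by linarith
    thus ?thesis
    proof
      assume "nat \<bar>k\<bar> = Suc (nat \<bar>k - 1\<bar>)"
      thus ?thesis by (simp only: power_Suc) simp
    next
      assume "nat \<bar>k - 1\<bar> = Suc (nat \<bar>k\<bar>)"
      thus ?thesis by (simp only: power_Suc) simp
    qed
  qed
  have t2: "k * (k - 1) div 2 = (k - 2) * (k - 1) div 2 + (k - 1)"
    using triangle_step[of "k - 1"] by (simp add: algebra_simps)
  have "Suc n + nat ((k - 1) * k div 2) = nat (int n + 1 - k) + nat (k * (k + 1) div 2)"
    using triangle_step[of k] triangle_nonneg[of k] triangle_nonneg[of "k-1"] assms by simp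
  moreover have "n + nat ((k - 1) * (k - 2) div 2) = nat (int n + 1 - k) + nat (k * (k - 1) div 2)"
    using t2 triangle_nonneg[of k] triangle_nonneg[of "k-1"] assms
    by (simp add: algebra_simps)
  ultimately have A: "a ^ Suc n * a ^ nat ((k - 1) * k div 2) = a ^ nat (int n + 1 - k) * a ^ nat (k * (k + 1) div 2)"
    and B: "b ^ n * b ^ nat ((k - 1) * (k - 2) div 2) = b ^ nat (int n + 1 - k) * b ^ nat (k * (k - 1) div 2)"
    by (simp_all only: power_add [symmetric])
  define s where "s = ((- 1) ^ nat \<bar>k - 1\<bar> :: 'a)"
  have "a * (a * b) ^ n * theta_term a b (k - 1) =
     s * (a ^ Suc n * a ^ nat ((k - 1) * k div 2)) * (b ^ n * b ^ nat ((k - 1) * (k - 2) div 2))"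
    unfolding theta_term_def power_mult_distrib s_def by (simp add: mult_ac)
  also have "\<dots> = - ((a * b) ^ nat (int n + 1 - k) * theta_term a b k)"
    unfolding A B theta_term_def power_mult_distrib s s_def by (simp add: mult_ac)
  finally show ?thesis .
qed

text \<open>The sum side of the finite triple product: \<open>theta_term a b k\<close> times the
  q-binomial coefficient of n + m over m + k. Separate bounds n and m let each of the two products
  grow by one factor at a time.\<close>

definition finite_theta :: "'a::field fps \<Rightarrow> 'a fps \<Rightarrow> nat \<Rightarrow> nat \<Rightarrow> 'a fps" where
  "finite_theta a b n m = qpoch (a * b) (a * b) (n + m) *
     (\<Sum>k\<in>{- int m..int n}. theta_term a b k *
        (inv_qfact (a * b) (int m + k) * inv_qfact (a * b) (int n - k)))"

lemma finite_theta_swap: "finite_theta a b n m = finite_theta b a m n"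
proof -
  have "(\<Sum>k\<in>{- int m..int n}. theta_term a b k * (inv_qfact (a * b) (int m + k) * inv_qfact (a * b) (int n - k))) =
    (\<Sum>k\<in>{- int n..int m}. theta_term b a k * (inv_qfact (a * b) (int n + k) * inv_qfact (a * b) (int m - k)))"
  proof (rule sum.reindex_bij_witness[of _ uminus uminus])
    fix k :: int
    show "theta_term b a (- k) * (inv_qfact (a * b) (int n + - k) * inv_qfact (a * b) (int m - - k)) =
      theta_term a b k * (inv_qfact (a * b) (int m + k) * inv_qfact (a * b) (int n - k))"
      unfolding theta_term_swap by (simp add: mult.commute)
  qed auto
  thus ?thesis unfolding finite_theta_def mult.commute[of b a] add.commute[of m n] by (rule arg_cong)
qed

lemma finite_theta_Suc:
  assumes "(a * b) $ 0 = 0"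
  shows "finite_theta a b (Suc n) m = (1 - a * (a * b) ^ n) * finite_theta a b n m"
proof -
  define q where "q = a * b"
  define I where "I = inv_qfact q"
  define A where "A = {- int m..int n + 1}"
  have q0: "q $ 0 = 0" using assms by (simp add: q_def)
  have I_neg: "I i = 0" if "i < 0" for i using that by (simp add: I_def inv_qfact_def)
  \<comment> \<open>The sum is extended by k = n + 1 here and by k = - m - 1 below. Each new term
    contains \<open>I (- 1) = 0\<close>, and after the shift by one the second range is again
    \<open>A\<close>.\<close>
  have "(\<Sum>k\<in>{- int m..int n}. theta_term a b k * (I (int m + k) * I (int n - k))) =
     (\<Sum>k\<in>A. theta_term a b k * (I (int m + k) * I (int n - k)))"
    by (intro sum.mono_neutral_left) (auto simp: A_def I_neg)
  moreover have "(\<Sum>k\<in>{- int m..int n}. theta_term a b k * (I (int m + k) * I (int n - k))) =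
     (\<Sum>k\<in>{- int m - 1..int n}. theta_term a b k * (I (int m + k) * I (int n - k)))"
    by (intro sum.mono_neutral_left) (auto simp: I_neg)
  moreover have "\<dots> = (\<Sum>k\<in>A. theta_term a b (k - 1) * (I (int m + k - 1) * I (int n + 1 - k)))"
    by (rule sum.reindex_bij_witness[of _ "\<lambda>k. k - 1" "\<lambda>k. k + 1"]) (auto simp: A_def)
  ultimately have "(1 - a * q ^ n) * (\<Sum>k\<in>{- int m..int n}. theta_term a b k * (I (int m + k) * I (int n - k))) =
     (\<Sum>k\<in>A. theta_term a b k * (I (int m + k) * I (int n - k))) - a * q ^ n *
       (\<Sum>k\<in>A. theta_term a b (k - 1) * (I (int m + k - 1) * I (int n + 1 - k)))"
    by (simp only: left_diff_distrib mult_1)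
  also have "\<dots> = 
     (\<Sum>k\<in>A. theta_term a b k * (I (int m + k) * I (int n - k)) - 
        a * q ^ n * (theta_term a b (k - 1) * (I (int m + k - 1) * I (int n + 1 - k))))"
    by (simp only: sum_subtractf sum_distrib_left)
  also have "\<dots> = (\<Sum>k\<in>A. theta_term a b k * ((1 - q ^ Suc (n + m)) * I (int m + k) * I (int n + 1 - k)))"
  proof (rule sum.cong)
    fix k assume k: "k \<in> A"
    hence "nat (int m + k + (int n + 1 - k)) = Suc (n + m)" by simp
    with qpascal[OF q0, of "int m + k" "int n + 1 - k"] k
    have p: "I (int m + k) * I (int n - k) + q ^ nat (int n + 1 - k) * I (int m + k - 1) * I (int n + 1 - k) =
      (1 - q ^ Suc (n + m)) * I (int m + k) * I (int n + 1 - k)"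
      by (simp add: A_def I_def)
    have s: "a * q ^ n * theta_term a b (k - 1) = - (q ^ nat (int n + 1 - k) * theta_term a b k)"
      using theta_term_step[of k n a b] k by (simp add: A_def q_def)
    have "theta_term a b k * (I (int m + k) * I (int n - k)) - 
        a * q ^ n * (theta_term a b (k - 1) * (I (int m + k - 1) * I (int n + 1 - k))) =
      theta_term a b k * (I (int m + k) * I (int n - k)) - 
        a * q ^ n * theta_term a b (k - 1) * (I (int m + k - 1) * I (int n + 1 - k))"
      by (simp add: mult_ac)
    also have "\<dots> = theta_term a b k * (I (int m + k) * I (int n - k) + q ^ nat (int n + 1 - k) * I (int m + k - 1) * I (int n + 1 - k))"
      unfolding s by (simp add: algebra_simps)
    finally show "theta_term a b k * (I (int m + k) * I (int n - k)) - 
        a * q ^ n * (theta_term a b (k - 1) * (I (int m + k - 1) * I (int n + 1 - k))) =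
      theta_term a b k * ((1 - q ^ Suc (n + m)) * I (int m + k) * I (int n + 1 - k))"
      unfolding p .
  qed simp
  also have "\<dots> = (1 - q * q ^ (n + m)) * (\<Sum>k\<in>A. theta_term a b k * (I (int m + k) * I (int (Suc n) - k)))"
    by (simp add: sum_distrib_left mult_ac add_ac)
  finally have "(1 - a * q ^ n) * (\<Sum>k\<in>{- int m..int n}. theta_term a b k * (I (int m + k) * I (int n - k))) = \<dots>" .
  moreover have "A = {- int m..int (Suc n)}" by (auto simp: A_def)
  moreover have "finite_theta a b (Suc n) m = qpoch q q (n + m) * ((1 - q * q ^ (n + m)) * 
     (\<Sum>k\<in>{- int m..int (Suc n)}. theta_term a b k * (I (int m + k) * I (int (Suc n) - k))))"
    unfolding finite_theta_def I_def q_def by (simp add: qpoch_Suc mult_ac)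
  moreover have "(1 - a * (a * b) ^ n) * finite_theta a b n m = qpoch q q (n + m) * ((1 - a * q ^ n) * 
     (\<Sum>k\<in>{- int m..int n}. theta_term a b k * (I (int m + k) * I (int n - k))))"
    unfolding finite_theta_def I_def q_def by (simp add: mult_ac)
  ultimately show ?thesis by simp
qed

theorem finite_jacobi_triple_product:
  assumes "(a * b) $ 0 = 0"
  shows "finite_theta a b n m = qpoch a (a * b) n * qpoch b (a * b) m"
proof (induction n)
  case 0
  show ?case
  proof (induction m)
    case 0
    show ?case by (simp add: finite_theta_def theta_term_def inv_qfact_def)
  next
    case (Suc m)
    have "finite_theta a b 0 (Suc m) = finite_theta b a (Suc m) 0" by (rule finite_theta_swap)
    also have "\<dots> = (1 - b * (b * a) ^ m) * finite_theta b a m 0"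
      by (rule finite_theta_Suc) (use assms in \<open>simp add: mult.commute\<close>)
    also have "finite_theta b a m 0 = finite_theta a b 0 m" by (rule finite_theta_swap)
    finally show ?case by (simp add: Suc.IH qpoch_Suc mult_ac)
  qed
next
  case (Suc n)
  show ?case by (simp add: finite_theta_Suc[OF assms] Suc.IH qpoch_Suc mult_ac)
qed

text \<open>Only the product a * b is known to have zero constant term, so both exponents must be
  large in order to extract (a b)^N. The smaller one is at least |k| - 1, by (k - 2) (k - 1) \<ge> 0
  for positive k and (k + 2) (k + 1) \<ge> 0 otherwise.\<close>

lemma theta_term_dvd:
  fixes a b :: "'a::field fps"
  assumes "(a * b) $ 0 = 0" "\<bar>k\<bar> > int N"
  shows "fps_X ^ N dvd theta_term a b k"
proof -
  have "2 * int N \<le> k * (k + 1) \<and> 2 * int N \<le> k * (k - 1)"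
  proof (cases "k > 0")
    case True
    have "(k - 2) * (k - 1) \<ge> 0" using True by (cases "k = 1") auto
    moreover have "k \<ge> int N + 1" using True assms by simp
    ultimately show ?thesis using True by (simp add: algebra_simps)
  next
    case False
    have "(k + 2) * (k + 1) \<ge> 0"
      using False by (cases "k = -1 \<or> k = 0") (auto intro: mult_nonpos_nonpos)
    moreover have "k \<le> - int N - 1" using False assms by simp
    ultimately show ?thesis using False by (simp add: algebra_simps)
  qed
  hence "N \<le> nat (k * (k + 1) div 2)" "N \<le> nat (k * (k - 1) div 2)" by linarith+
  hence "a ^ N * b ^ N dvd a ^ nat (k * (k + 1) div 2) * b ^ nat (k * (k - 1) div 2)"
    by (intro mult_dvd_mono le_imp_power_dvd)
  moreover have "fps_X ^ N dvd a ^ N * b ^ N"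
    using fps_X_power_dvd_power[OF assms(1)] by (simp add: power_mult_distrib)
  ultimately show ?thesis unfolding theta_term_def
    by (metis (no_types, lifting) dvd_mult dvd_trans mult.assoc)
qed

text \<open>Take n = m in the finite identity, with n \<ge> 2 N. Modulo \<open>fps_X ^ N\<close> the
  terms with |k| > N vanish; for the others n + k and n - k are at least N, so both inverse
  q-factorials become \<open>inverse L\<close>. Of the resulting \<open>L * L\<close>, one factor
  cancels against the limit of \<open>qpoch q q (n + n)\<close>.\<close>

theorem jacobi_triple_product:
  assumes q0: "(a * b) $ 0 = 0" and "a $ 0 \<noteq> 1" "b $ 0 \<noteq> 1"
  shows "(\<lambda>n. \<Sum>k\<in>{- int n..int n}. theta_term a b k) \<longlonglongrightarrow>
    qpoch_inf a (a * b) * qpoch_inf b (a * b) * qpoch_inf (a * b) (a * b)"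
proof -
  define q where "q = a * b"
  define L where "L = qpoch_inf q q"
  define S where "S = (\<lambda>n. \<Sum>k\<in>{- int n..int n}. theta_term a b k)"
  have q0: "q $ 0 = 0" using q0 by (simp add: q_def)
  note lim = qpoch_tendsto[OF q0]
  have L0: "L $ 0 = 1" using lim(2)[of q] q0 by (simp add: L_def)
  have P0: "qpoch q q n $ 0 = 1" for n by (simp add: qpoch_fps_nth_0 q0)
  have I: "fps_cong N (inv_qfact q i) (inverse L)" if "i \<ge> int N" for i N
  proof -
    have "fps_cong N (qpoch q q (nat i)) L" unfolding L_def
      by (rule fps_cong_mono[OF lim(3)]) (use that q0 in auto)
    thus ?thesis using that P0 L0 by (auto simp: inv_qfact_def intro!: fps_cong_inverse)
  qed
  have summand: "fps_cong N (theta_term a b k * (inv_qfact q (int n + k) * inv_qfact q (int n - k)))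
        (theta_term a b k * (inverse L * inverse L))" if "n \<ge> 2 * N" for n k N
  proof (cases "\<bar>k\<bar> > int N")
    case True
    have "fps_X ^ N dvd theta_term a b k"
      using theta_term_dvd[of a b N k] q0 True by (simp add: q_def)
    thus ?thesis unfolding fps_cong_def by (simp add: dvd_diff)
  next
    case False
    thus ?thesis using that by (intro fps_cong_mult I) auto
  qed
  define R where "R = (\<lambda>n. qpoch a q n * qpoch b q n * inverse (qpoch q q (n + n)) * (L * L))"
  have "fps_cong N (S n) (R n)" if "n \<ge> 2 * N" for n N
  proof -
    have "fps_cong N (\<Sum>k\<in>{- int n..int n}. theta_term a b k * (inv_qfact q (int n + k) * inv_qfact q (int n - k)))
       (\<Sum>k\<in>{- int n..int n}. theta_term a b k * (inverse L * inverse L))"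
      by (intro fps_cong_sum summand that)
    also have "\<dots> = S n * (inverse L * inverse L)" by (simp add: S_def sum_distrib_right)
    finally have "fps_cong N (qpoch q q (n + n) * (\<Sum>k\<in>{- int n..int n}. theta_term a b k * (inv_qfact q (int n + k) * inv_qfact q (int n - k))))
       (qpoch q q (n + n) * (S n * (inverse L * inverse L)))"
      by (intro fps_cong_mult fps_cong_refl)
    hence "fps_cong N (qpoch a q n * qpoch b q n) (qpoch q q (n + n) * (S n * (inverse L * inverse L)))"
      using finite_jacobi_triple_product[of a b n n] q0 unfolding finite_theta_def q_def by simp
    hence "fps_cong N (qpoch a q n * qpoch b q n * (inverse (qpoch q q (n + n)) * (L * L)))
       (qpoch q q (n + n) * (S n * (inverse L * inverse L)) * (inverse (qpoch q q (n + n)) * (L * L)))"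
      by (rule fps_cong_mult[OF _ fps_cong_refl])
    moreover have "qpoch q q (n + n) * (S n * (inverse L * inverse L)) * (inverse (qpoch q q (n + n)) * (L * L)) = S n"
    proof -
      have 1: "inverse L * L = 1" using L0 by (simp add: inverse_mult_eq_1)
      have 2: "inverse (qpoch q q (n + n)) * qpoch q q (n + n) = 1" using P0 by (simp add: inverse_mult_eq_1)
      have "qpoch q q (n + n) * (S n * (inverse L * inverse L)) * (inverse (qpoch q q (n + n)) * (L * L)) =
        S n * (inverse L * L) * (inverse L * L) * (inverse (qpoch q q (n + n)) * qpoch q q (n + n))"
        by (simp only: mult_ac)
      thus ?thesis unfolding 1 2 by simp
    qed
    ultimately show ?thesis unfolding R_def by (metis fps_cong_sym mult.assoc)
  qed
  hence "\<And>N. eventually (\<lambda>n. fps_cong N (S n) (R n)) sequentially"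
    using eventually_ge_at_top by (metis (mono_tags, lifting) eventually_mono)
  moreover have "R \<longlonglongrightarrow> qpoch_inf a q * qpoch_inf b q * inverse L * (L * L)"
  proof -
    have "(\<lambda>n. qpoch q q (n + n)) \<longlonglongrightarrow> L"
      using LIMSEQ_subseq_LIMSEQ[OF lim(1)[of q], of "\<lambda>n. n + n"] q0
      by (simp add: L_def strict_mono_def comp_def)
    thus ?thesis unfolding R_def using assms q0 L0
      by (intro tendsto_mult_fps lim tendsto_const tendsto_inverse_fps) auto
  qed
  ultimately have "S \<longlonglongrightarrow> qpoch_inf a q * qpoch_inf b q * inverse L * (L * L)"
    by (rule tendsto_fps_congI)
  also have "qpoch_inf a q * qpoch_inf b q * inverse L * (L * L) = qpoch_inf a q * qpoch_inf b q * L"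
  proof -
    have "inverse L * L = 1" using L0 by (simp add: inverse_mult_eq_1)
    thus ?thesis by (metis (no_types) mult.assoc mult_1)
  qed
  finally show ?thesis by (simp add: S_def q_def L_def)
qed

section \<open>Dissection at fifth roots of unity\<close>

lemma theta_term_sign: "(- 1) ^ nat \<bar>k\<bar> = (if even k then 1 else - 1 :: 'a::ring_1)"
  by (simp add: minus_one_power_iff even_nat_iff)

text \<open>Naming the triangular number \<open>t\<close> removes \<open>div\<close> and makes the
  exponent identities below linear in \<open>t\<close> and \<open>k\<close>.\<close>

lemma triangle_cases:
  obtains t :: int where "k * (k - 1) div 2 = t" "k * (k + 1) div 2 = t + k" "k * k = 2 * t + k" "t \<ge> 0" "t + k \<ge> 0"
proof -
  have "even (k * (k - 1))" by simp
  then obtain t where "k * (k - 1) = 2 * t" by (elim evenE)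
  hence "k * (k - 1) div 2 = t" "k * (k + 1) div 2 = t + k" "k * k = 2 * t + k"
    using triangle_step[of k] by (auto simp: algebra_simps)
  with triangle_nonneg[of k] that show thesis by metis
qed

lemma triangle_5:
  fixes j r :: int
  assumes "j * (j - 1) div 2 = t" "j * j = 2 * t + j" "r * (r - 1) = 2 * u"
  shows "(5 * j + r) * (5 * j + r - 1) div 2 = 25 * t + (10 + 5 * r) * j + u"
proof -
  have "(5 * j + r) * (5 * j + r - 1) = 25 * (j * j) + (10 * r - 5) * j + r * (r - 1)"
    by (simp add: algebra_simps)
  also have "\<dots> = 2 * (25 * t + (10 + 5 * r) * j + u)"
    unfolding assms(2,3) by (simp add: algebra_simps)
  finally show ?thesis by simp
qed

lemma power_mod_5: "z ^ 5 = 1 \<Longrightarrow> z ^ (n mod 5) = (z :: 'a::monoid_mult) ^ n"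
  by (metis div_mult_mod_eq mult.commute mult_1 power_add power_mult power_one)

text \<open>With t = k (k - 1) / 2, the total exponent of z is (t + k) + 4 t = 5 t + k, which is k
  modulo 5.\<close>

lemma theta_term_root:
  fixes z :: "'a::field"
  assumes "z ^ 5 = 1"
  shows "theta_term (fps_const z) (fps_const (z ^ 4) * fps_X) k =
    (if even k then 1 else - 1) * fps_const (z ^ nat (k mod 5)) * fps_X ^ nat (k * (k - 1) div 2)"
proof -
  obtain t where t: "k * (k - 1) div 2 = t" "k * (k + 1) div 2 = t + k" "t \<ge> 0" "t + k \<ge> 0"
    by (rule triangle_cases)
  define m where "m = nat (t + k) + 4 * nat t"
  have "int m = 5 * t + k" using t by (simp add: m_def)
  hence "int (m mod 5) = k mod 5" by (simp add: zmod_int)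
  hence "m mod 5 = nat (k mod 5)" by linarith
  hence "z ^ nat (k mod 5) = z ^ m" using power_mod_5[OF assms, of m] by simp
  thus ?thesis unfolding theta_term_def theta_term_sign t
    by (simp add: power_mult_distrib power_add m_def power_mult flip: fps_const_power fps_const_mult)
qed

lemma theta_term_X:
  fixes j :: int
  shows "theta_term (fps_X ^ m) (fps_X ^ n :: 'a::field fps) j =
    (if even j then 1 else - 1) * fps_X ^ (m * nat (j * (j + 1) div 2) + n * nat (j * (j - 1) div 2))"
  by (simp add: theta_term_def theta_term_sign power_mult power_add mult.assoc)

text \<open>The exponent k (k - 1) / 2 is 0 modulo 5 for k congruent to 0 or 1, it is 1 for k
  congruent to 2 or -1, and 3 for k congruent to -2. Each class is again a theta series with base
  q^25, and the reflection of j identifies the two classes in each pair.\<close>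

lemma theta_dissection_terms:
  fixes z :: "'a::field" and j :: int
  assumes "z ^ 5 = 1"
  defines "\<theta> \<equiv> theta_term (fps_const z) (fps_const (z ^ 4) * fps_X)"
    and "U \<equiv> theta_term (fps_X ^ 10) (fps_X ^ 15 :: 'a fps)"
    and "V \<equiv> theta_term (fps_X ^ 5) (fps_X ^ 20 :: 'a fps)"
    and "W \<equiv> theta_term (fps_X ^ 0) (fps_X ^ 25 :: 'a fps)"
  shows "\<theta> (5 * j) = U j" "\<theta> (5 * j + 1) = - fps_const z * U (- j)"
    "\<theta> (5 * j + 2) = fps_const (z ^ 2) * fps_X * V (- j)"
    "\<theta> (5 * j - 1) = - fps_const (z ^ 4) * fps_X * V j"
    "\<theta> (5 * j - 2) = fps_const (z ^ 3) * fps_X ^ 3 * W j"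
proof -
  obtain t where t: "j * (j - 1) div 2 = t" "j * (j + 1) div 2 = t + j" "j * j = 2 * t + j" "t \<ge> 0" "t + j \<ge> 0"
    by (rule triangle_cases)
  have t': "- j * (- j + 1) div 2 = t" "- j * (- j - 1) div 2 = t + j"
    using t(1,2) by (simp_all add: algebra_simps)
  note tri = triangle_5[OF t(1,3)]
  have e: "nat (25 * t + 10 * j) = 10 * nat (t + j) + 15 * nat t"
    "nat (25 * t + 15 * j) = 10 * nat t + 15 * nat (t + j)"
    "nat (25 * t + 20 * j + 1) = Suc (5 * nat t + 20 * nat (t + j))"
    "nat (25 * t + 5 * j + 1) = Suc (5 * nat (t + j) + 20 * nat t)"
    "nat (25 * t + 3) = 3 + 25 * nat t"
    using t by (simp_all add: nat_eq_iff nat_add_distrib)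
  note unf = \<theta>_def U_def V_def W_def theta_term_root[OF assms(1)] theta_term_X t t'
  show "\<theta> (5 * j) = U j"
    using tri[of 0 0] e(1) unfolding unf by simp
  show "\<theta> (5 * j + 1) = - fps_const z * U (- j)"
    using tri[of 1 0] e(2) unfolding unf by (simp add: mod_add_eq)
  show "\<theta> (5 * j + 2) = fps_const (z ^ 2) * fps_X * V (- j)"
    using tri[of 2 1] e(3) unfolding unf by (simp add: mult_ac)
  have m: "(5 * j - 1) mod 5 = 4" "(5 * j - 2) mod 5 = 3" by presburger+
  show "\<theta> (5 * j - 1) = - fps_const (z ^ 4) * fps_X * V j"
    using tri[of "-1" 1] e(4) m unfolding unf by (simp add: mult_ac)
  show "\<theta> (5 * j - 2) = fps_const (z ^ 3) * fps_X ^ 3 * W j"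
    using tri[of "-2" 3] e(5) m unfolding unf by (simp add: power_add mult_ac)
qed

text \<open>The centred residues -2, ..., 2 split a symmetric range of radius 5 n + 2 into complete
  blocks with a symmetric range for j.\<close>

lemma sum_int_mod_5:
  fixes f :: "int \<Rightarrow> 'a::comm_monoid_add"
  shows "(\<Sum>k\<in>{- int (5 * n + 2)..int (5 * n + 2)}. f k) =
    (\<Sum>j\<in>{- int n..int n}. f (5 * j - 2) + f (5 * j - 1) + f (5 * j) + f (5 * j + 1) + f (5 * j + 2))"
proof -
  have "(\<Sum>j\<in>{- int n..int n}. f (5 * j - 2) + f (5 * j - 1) + f (5 * j) + f (5 * j + 1) + f (5 * j + 2)) =
    (\<Sum>j\<in>{- int n..int n}. \<Sum>r\<in>{-2..2}. f (5 * j + r))"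
  proof (rule sum.cong)
    fix j show "f (5 * j - 2) + f (5 * j - 1) + f (5 * j) + f (5 * j + 1) + f (5 * j + 2) = (\<Sum>r\<in>{-2..2}. f (5 * j + r))"
    proof -
      have "{-2..2::int} = {-2, -1, 0, 1, 2}" by auto
      thus ?thesis by (simp add: add_ac)
    qed
  qed simp
  also have "\<dots> = (\<Sum>(j, r)\<in>{- int n..int n} \<times> {-2..2}. f (5 * j + r))"
    by (rule sum.cartesian_product)
  also have "\<dots> = (\<Sum>k\<in>{- int (5 * n + 2)..int (5 * n + 2)}. f k)"
  \<comment> \<open>Adding 2 before dividing and subtracting it from the remainder gives the centred
    residue.\<close>
  proof (rule sum.reindex_bij_witness[of _ "\<lambda>k. ((k + 2) div 5, (k + 2) mod 5 - 2)" "\<lambda>(j, r). 5 * j + r"])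
    fix a :: "int \<times> int" assume "a \<in> {- int n..int n} \<times> {-2..2}"
    then obtain j r where a: "a = (j, r)" "- int n \<le> j" "j \<le> int n" "-2 \<le> r" "r \<le> 2" by auto
    have "(5 * j + r + 2) div 5 = j" "(5 * j + r + 2) mod 5 = r + 2" using a by presburger+
    thus "(((case a of (j, r) \<Rightarrow> 5 * j + r) + 2) div 5, ((case a of (j, r) \<Rightarrow> 5 * j + r) + 2) mod 5 - 2) = a"
      "(case a of (j, r) \<Rightarrow> 5 * j + r) \<in> {- int (5 * n + 2)..int (5 * n + 2)}"
      "f (case a of (j, r) \<Rightarrow> 5 * j + r) = (case a of (j, r) \<Rightarrow> f (5 * j + r))"
      using a by simp_all
  next
    fix k :: int assume k: "k \<in> {- int (5 * n + 2)..int (5 * n + 2)}"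
    show "(case ((k + 2) div 5, (k + 2) mod 5 - 2) of (j, r) \<Rightarrow> 5 * j + r) = k"
      unfolding prod.case using mult_div_mod_eq[of 5 "k + 2"] by linarith
    have "(k + 2) div 5 \<ge> - int n" "(k + 2) div 5 \<le> int n" "(k + 2) mod 5 \<ge> 0" "(k + 2) mod 5 < 5"
      using k by (simp_all, linarith+)
    thus "((k + 2) div 5, (k + 2) mod 5 - 2) \<in> {- int n..int n} \<times> {-2..2}" by simp
  qed
  finally show ?thesis ..
qed

lemma sum_int_symmetric:
  fixes f :: "int \<Rightarrow> 'a::comm_monoid_add"
  shows "(\<Sum>j\<in>{- int n..int n}. f (- j)) = (\<Sum>j\<in>{- int n..int n}. f j)"
  by (rule sum.reindex_bij_witness[of _ uminus uminus]) auto

lemma sum_int_Suc: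
  fixes f :: "int \<Rightarrow> 'a::comm_monoid_add"
  shows "(\<Sum>j\<in>{- int (Suc n)..int (Suc n)}. f j) = (\<Sum>j\<in>{- int n..int n}. f j) + f (- int (Suc n)) + f (int (Suc n))"
proof -
  have "{- int (Suc n)..int (Suc n)} = insert (- int (Suc n)) (insert (int (Suc n)) {- int n..int n})" by auto
  thus ?thesis by (simp add: add_ac)
qed

text \<open>The terms at j and 1 - j cancel, so in the range from -n to n only the one at j = - n is
  left over.\<close>

lemma theta_1_partial_sum:
  fixes q :: "'a::comm_ring_1"
  shows "(\<Sum>j\<in>{- int n..int n}. theta_term 1 q j) = (- 1) ^ n * q ^ (n * (n + 1) div 2)"
proof (induction n)
  case (Suc n)
  have "theta_term 1 q (- int (Suc n)) = (- 1) ^ Suc n * q ^ (Suc n * (Suc n + 1) div 2)"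
  proof -
    have "- int (Suc n) * (- int (Suc n) - 1) = int (Suc n * (Suc n + 1))" by (simp add: algebra_simps)
    hence "- int (Suc n) * (- int (Suc n) - 1) div 2 = int (Suc n * (Suc n + 1) div 2)"
      by (simp only: zdiv_int of_nat_numeral)
    hence "nat (- int (Suc n) * (- int (Suc n) - 1) div 2) = Suc n * (Suc n + 1) div 2" by (simp only: nat_int)
    moreover have "nat \<bar>- int (Suc n)\<bar> = Suc n" by simp
    ultimately show ?thesis unfolding theta_term_def by (simp only: power_one mult_1_right)
  qed
  moreover have "theta_term 1 q (int (Suc n)) = (- 1) ^ Suc n * q ^ (n * (n + 1) div 2)"
  proof -
    have "int (Suc n) * (int (Suc n) - 1) = int (n * (n + 1))" by (simp add: algebra_simps)
    hence "int (Suc n) * (int (Suc n) - 1) div 2 = int (n * (n + 1) div 2)"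
      by (simp only: zdiv_int of_nat_numeral)
    hence "nat (int (Suc n) * (int (Suc n) - 1) div 2) = n * (n + 1) div 2" by (simp only: nat_int)
    moreover have "nat \<bar>int (Suc n)\<bar> = Suc n" by simp
    ultimately show ?thesis unfolding theta_term_def by (simp only: power_one mult_1_right)
  qed
  ultimately show ?case unfolding sum_int_Suc Suc.IH by simp
qed (simp add: theta_term_def)

text \<open>The degenerate triple product, whose factor 1 - a is zero;
  \<open>jacobi_triple_product\<close> excludes constant term 1, so the partial sums are evaluated
  directly.\<close>

lemma theta_1_tendsto:
  fixes q :: "'a::field fps"
  assumes "q $ 0 = 0"
  shows "(\<lambda>n. \<Sum>j\<in>{- int n..int n}. theta_term 1 q j) \<longlonglongrightarrow> 0"
proof (rule tendsto_fps_congI[OF _ tendsto_const])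
  fix N
  have "fps_cong N (\<Sum>j\<in>{- int n..int n}. theta_term 1 q j) 0" if "n \<ge> N" for n
  proof -
    have "N \<le> n * (n + 1) div 2"
    proof -
      have "2 * n \<le> n * (n + 1)" by (cases n) auto
      thus ?thesis using that by linarith
    qed
    hence "q ^ N dvd q ^ (n * (n + 1) div 2)" by (rule le_imp_power_dvd)
    hence "fps_X ^ N dvd q ^ (n * (n + 1) div 2)"
      using fps_X_power_dvd_power[OF assms] dvd_trans by blast
    thus ?thesis unfolding theta_1_partial_sum fps_cong_0_iff by (rule dvd_mult)
  qed
  thus "eventually (\<lambda>n. fps_cong N (\<Sum>j\<in>{- int n..int n}. theta_term 1 q j) 0) sequentially"
    using eventually_ge_at_top by (metis (mono_tags, lifting) eventually_mono)
qed

lemma qpoch_inf_split_first: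
  assumes "q $ 0 = 0" "a $ 0 \<noteq> 1"
  shows "qpoch_inf a q = (1 - a) * qpoch_inf (a * q) q"
proof (rule LIMSEQ_unique)
  show "(\<lambda>n. qpoch a q (Suc n)) \<longlonglongrightarrow> qpoch_inf a q"
    by (rule LIMSEQ_Suc[OF qpoch_tendsto(1)[OF assms]])
  show "(\<lambda>n. qpoch a q (Suc n)) \<longlonglongrightarrow> (1 - a) * qpoch_inf (a * q) q"
    unfolding qpoch_Suc_left using assms
    by (intro tendsto_mult_fps tendsto_const qpoch_tendsto(1)) auto
qed

lemma sum_powers_root_5:
  fixes z :: "'a::field"
  assumes "z ^ 5 = 1" "z \<noteq> 1"
  shows "1 + z + z ^ 2 + z ^ 3 + z ^ 4 = 0"
proof -
  have "(1 - z) * (1 + z + z ^ 2 + z ^ 3 + z ^ 4) = 1 - z ^ 5"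
    by (simp add: algebra_simps power_numeral_reduce)
  thus ?thesis using assms by simp
qed

text \<open>With a = z and b = z^4 q, the classes 0 and 1 combine to 1 - z times the first product,
  the classes 2 and -1 to (z^2 - z^4) q times the second, and the class -2 tends to 0. The factor 1
  - z divides both coefficients and also splits off from \<open>qpoch_inf a fps_X\<close>.\<close>

lemma triple_product_root_5:
  fixes z :: complex
  assumes z: "z ^ 5 = 1" "z \<noteq> 1"
  defines "Q \<equiv> fps_X ^ 5"
  shows "qpoch_inf (fps_const z * fps_X) fps_X * qpoch_inf (fps_const (z ^ 4) * fps_X) fps_X * qpoch_inf fps_X fps_X =
     qpoch_inf (Q ^ 2) (Q ^ 5) * qpoch_inf (Q ^ 3) (Q ^ 5) * qpoch_inf (Q ^ 5) (Q ^ 5) +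
     fps_const (z ^ 2 + z ^ 3) * fps_X * (qpoch_inf Q (Q ^ 5) * qpoch_inf (Q ^ 4) (Q ^ 5) * qpoch_inf (Q ^ 5) (Q ^ 5))"
    (is "?L = ?U + _ * _ * ?V")
proof -
  define a where "a = fps_const z"
  define b where "b = fps_const (z ^ 4) * fps_X"
  define s where "s = (\<lambda>f n. \<Sum>j\<in>{- int n..int n}. f j :: complex fps)"
  define U where "U = theta_term (fps_X ^ 10) (fps_X ^ 15 :: complex fps)"
  define V where "V = theta_term (fps_X ^ 5) (fps_X ^ 20 :: complex fps)"
  define W where "W = theta_term (fps_X ^ 0) (fps_X ^ 25 :: complex fps)"
  have ab: "a * b = fps_X"
    using z(1) by (simp add: a_def b_def mult.assoc [symmetric] power_numeral_reduce)
  have "s (theta_term a b) \<longlonglongrightarrow> qpoch_inf a fps_X * qpoch_inf b fps_X * qpoch_inf fps_X fps_X"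
    using jacobi_triple_product[of a b] z unfolding ab s_def by (simp add: a_def b_def)
  \<comment> \<open>Partial sums of index 5 n + 2 consist of complete blocks of five
    residues.\<close>
  from LIMSEQ_subseq_LIMSEQ[OF this, of "\<lambda>n. 5 * n + 2"]
  have 1: "(\<lambda>n. s (theta_term a b) (5 * n + 2)) \<longlonglongrightarrow> qpoch_inf a fps_X * qpoch_inf b fps_X * qpoch_inf fps_X fps_X"
    by (simp add: comp_def strict_mono_def)
  have "s (theta_term a b) (5 * n + 2) = fps_const (1 - z) * s U n + fps_const (z ^ 2 - z ^ 4) * fps_X * s V n
      + fps_const (z ^ 3) * fps_X ^ 3 * s W n" for n
  proof -
    have "s (theta_term a b) (5 * n + 2) = fps_const (z ^ 3) * fps_X ^ 3 * s W n - fps_const (z ^ 4) * fps_X * s V n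
       + s U n - fps_const z * s (\<lambda>j. U (- j)) n + fps_const (z ^ 2) * fps_X * s (\<lambda>j. V (- j)) n"
      unfolding s_def sum_int_mod_5 a_def b_def theta_dissection_terms[OF z(1)] U_def V_def W_def
      by (simp add: sum.distrib sum_subtractf sum_distrib_left sum_negf del: fps_const_neg)
    also have "s (\<lambda>j. U (- j)) n = s U n" unfolding s_def by (rule sum_int_symmetric)
    also have "s (\<lambda>j. V (- j)) n = s V n" unfolding s_def by (rule sum_int_symmetric)
    finally show ?thesis by (simp add: algebra_simps flip: fps_const_sub)
  qed
  moreover have "s U \<longlonglongrightarrow> ?U"
    using jacobi_triple_product[of "fps_X ^ 10" "fps_X ^ 15"]
    by (simp add: s_def U_def Q_def power_mult [symmetric] power_add [symmetric])
  moreover have "s V \<longlonglongrightarrow> ?V"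
    using jacobi_triple_product[of "fps_X ^ 5" "fps_X ^ 20"]
    by (simp add: s_def V_def Q_def power_mult [symmetric] power_add [symmetric])
  moreover have "s W \<longlonglongrightarrow> 0"
    using theta_1_tendsto[of "fps_X ^ 25"] by (simp add: s_def W_def)
  ultimately have "(\<lambda>n. s (theta_term a b) (5 * n + 2)) \<longlonglongrightarrow>
      fps_const (1 - z) * ?U + fps_const (z ^ 2 - z ^ 4) * fps_X * ?V + fps_const (z ^ 3) * fps_X ^ 3 * 0"
    by (simp only:) (intro tendsto_add_fps tendsto_mult_fps tendsto_const)
  from LIMSEQ_unique[OF 1 this]
  have "qpoch_inf a fps_X * qpoch_inf b fps_X * qpoch_inf fps_X fps_X =
    fps_const (1 - z) * ?U + fps_const (z ^ 2 - z ^ 4) * fps_X * ?V" by simp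
  moreover have D: "fps_const (z ^ 2 - z ^ 4) = fps_const (1 - z) * fps_const (z ^ 2 + z ^ 3)"
    unfolding fps_const_mult by (simp add: algebra_simps power_numeral_reduce)
  moreover have "qpoch_inf a fps_X = fps_const (1 - z) * qpoch_inf (a * fps_X) fps_X"
    using qpoch_inf_split_first[of fps_X a] z by (simp add: a_def flip: fps_const_sub)
  ultimately have "fps_const (1 - z) * ?L = fps_const (1 - z) * (?U + fps_const (z ^ 2 + z ^ 3) * fps_X * ?V)"
    by (simp only: D a_def b_def distrib_left mult_ac)
  thus ?thesis using z by (metis eq_iff_diff_eq_0 fps_const_eq_0_iff mult_cancel_left)
qed

lemma prod_roots_5:
  fixes z :: "'a::field" and Y :: "'a fps"
  assumes "z ^ 5 = 1" "z \<noteq> 1"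
  defines "c \<equiv> fps_const z"
  shows "(1 - Y) * (1 - c * Y) * (1 - c ^ 4 * Y) * (1 - c ^ 2 * Y) * (1 - c ^ 3 * Y) = 1 - Y ^ 5"
proof -
  have "fps_const (1 + z + z ^ 2 + z ^ 3 + z ^ 4) = 0"
    using sum_powers_root_5[OF assms(1,2)] by simp
  hence "1 + c + c ^ 2 + c ^ 3 + c ^ 4 = 0"
    by (simp add: c_def fps_const_power flip: fps_const_add)
  thus ?thesis by algebra
qed

lemma qpoch_inf_roots_5:
  fixes z :: complex
  assumes "z ^ 5 = 1" "z \<noteq> 1"
  shows "qpoch_inf fps_X fps_X * qpoch_inf (fps_const z * fps_X) fps_X * qpoch_inf (fps_const (z ^ 4) * fps_X) fps_X *
    qpoch_inf (fps_const (z ^ 2) * fps_X) fps_X * qpoch_inf (fps_const (z ^ 3) * fps_X) fps_X =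
    qpoch_inf (fps_X ^ 5) (fps_X ^ 5)"
proof (rule LIMSEQ_unique)
  have "qpoch fps_X fps_X n * qpoch (fps_const z * fps_X) fps_X n * qpoch (fps_const (z ^ 4) * fps_X) fps_X n *
    qpoch (fps_const (z ^ 2) * fps_X) fps_X n * qpoch (fps_const (z ^ 3) * fps_X) fps_X n =
    qpoch (fps_X ^ 5) (fps_X ^ 5) n" for n
  proof -
    have *: "(1 - fps_X * fps_X ^ k) * (1 - fps_const z * fps_X * fps_X ^ k) * (1 - fps_const (z ^ 4) * fps_X * fps_X ^ k) *
      (1 - fps_const (z ^ 2) * fps_X * fps_X ^ k) * (1 - fps_const (z ^ 3) * fps_X * fps_X ^ k) =
      1 - fps_X ^ 5 * (fps_X ^ 5) ^ k" for k
      using prod_roots_5[OF assms, of "fps_X ^ Suc k"]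
      by (simp add: mult.assoc fps_const_power power_mult_distrib flip: power_mult) (simp add: mult.commute)
    show ?thesis by (simp add: qpoch_def * flip: prod.distrib)
  qed
  moreover have "(\<lambda>n. qpoch fps_X fps_X n * qpoch (fps_const z * fps_X) fps_X n * qpoch (fps_const (z ^ 4) * fps_X) fps_X n *
    qpoch (fps_const (z ^ 2) * fps_X) fps_X n * qpoch (fps_const (z ^ 3) * fps_X) fps_X n) \<longlonglongrightarrow>
    qpoch_inf fps_X fps_X * qpoch_inf (fps_const z * fps_X) fps_X * qpoch_inf (fps_const (z ^ 4) * fps_X) fps_X *
    qpoch_inf (fps_const (z ^ 2) * fps_X) fps_X * qpoch_inf (fps_const (z ^ 3) * fps_X) fps_X"
    by (intro tendsto_mult_fps qpoch_tendsto) auto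
  ultimately show "qpoch (fps_X ^ 5) (fps_X ^ 5) \<longlonglongrightarrow>
    qpoch_inf fps_X fps_X * qpoch_inf (fps_const z * fps_X) fps_X * qpoch_inf (fps_const (z ^ 4) * fps_X) fps_X *
    qpoch_inf (fps_const (z ^ 2) * fps_X) fps_X * qpoch_inf (fps_const (z ^ 3) * fps_X) fps_X" by simp
  show "qpoch (fps_X ^ 5) (fps_X ^ 5) \<longlonglongrightarrow> qpoch_inf (fps_X ^ 5 :: complex fps) (fps_X ^ 5)"
    by (rule qpoch_tendsto) auto
qed

lemma qpoch_inf_residues_5:
  fixes Q :: "complex fps"
  assumes "Q $ 0 = 0"
  shows "qpoch_inf Q Q = qpoch_inf Q (Q ^ 5) * qpoch_inf (Q ^ 2) (Q ^ 5) * qpoch_inf (Q ^ 3) (Q ^ 5) *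
    qpoch_inf (Q ^ 4) (Q ^ 5) * qpoch_inf (Q ^ 5) (Q ^ 5)"
proof (rule LIMSEQ_unique)
  have "qpoch Q Q (5 * n) = qpoch Q (Q ^ 5) n * qpoch (Q ^ 2) (Q ^ 5) n * qpoch (Q ^ 3) (Q ^ 5) n *
    qpoch (Q ^ 4) (Q ^ 5) n * qpoch (Q ^ 5) (Q ^ 5) n" for n
  proof (induction n)
    case (Suc n)
    have "qpoch Q Q (5 * Suc n) = qpoch Q Q (Suc (Suc (Suc (Suc (Suc (5 * n))))))"
      by (rule arg_cong) simp
    also have "\<dots> = qpoch Q Q (5 * n) * ((1 - Q * (Q ^ 5) ^ n) * (1 - Q ^ 2 * (Q ^ 5) ^ n) * (1 - Q ^ 3 * (Q ^ 5) ^ n) *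
        (1 - Q ^ 4 * (Q ^ 5) ^ n) * (1 - Q ^ 5 * (Q ^ 5) ^ n))"
    proof -
      have "(Q ^ 5) ^ n = Q ^ (5 * n)" by (simp add: power_mult)
      thus ?thesis unfolding qpoch_Suc by (simp add: power_numeral_reduce mult_ac)
    qed
    finally show ?case unfolding Suc.IH qpoch_Suc by (simp only: mult_ac)
  qed simp
  moreover have "(\<lambda>n. qpoch Q (Q ^ 5) n * qpoch (Q ^ 2) (Q ^ 5) n * qpoch (Q ^ 3) (Q ^ 5) n *
    qpoch (Q ^ 4) (Q ^ 5) n * qpoch (Q ^ 5) (Q ^ 5) n) \<longlonglongrightarrow> 
    qpoch_inf Q (Q ^ 5) * qpoch_inf (Q ^ 2) (Q ^ 5) * qpoch_inf (Q ^ 3) (Q ^ 5) *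
    qpoch_inf (Q ^ 4) (Q ^ 5) * qpoch_inf (Q ^ 5) (Q ^ 5)"
    using assms by (intro tendsto_mult_fps qpoch_tendsto) (auto simp: fps_nth_power_0)
  ultimately show "(\<lambda>n. qpoch Q Q (5 * n)) \<longlonglongrightarrow> 
    qpoch_inf Q (Q ^ 5) * qpoch_inf (Q ^ 2) (Q ^ 5) * qpoch_inf (Q ^ 3) (Q ^ 5) *
    qpoch_inf (Q ^ 4) (Q ^ 5) * qpoch_inf (Q ^ 5) (Q ^ 5)" by simp
  have "qpoch Q Q \<longlonglongrightarrow> qpoch_inf Q Q" using assms by (intro qpoch_tendsto) auto
  from LIMSEQ_subseq_LIMSEQ[OF this, of "\<lambda>n. 5 * n"]
  show "(\<lambda>n. qpoch Q Q (5 * n)) \<longlonglongrightarrow> qpoch_inf Q Q"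
    by (simp add: comp_def strict_mono_def)
qed

lemma fps_divide_iff:
  fixes f g h :: "'a::field fps"
  assumes "g $ 0 \<noteq> 0"
  shows "f / g = h \<longleftrightarrow> f = h * g"
proof -
  have "inverse g * g = 1" using assms by (rule inverse_mult_eq_1)
  thus ?thesis unfolding fps_divide_unit[OF assms]
    by (auto simp: mult.assoc mult.commute[of g])
qed

lemma crank_product_dissection:
  fixes z :: complex
  assumes z: "z ^ 5 = 1" "z \<noteq> 1"
  defines "q \<equiv> fps_X" and "c \<equiv> fps_const z"
  shows "qpoch_inf q q = qpoch_inf (c * q) q * qpoch_inf (c ^ 4 * q) q *
    (A_ser (q ^ 5) + (c + c ^ 4 - 1) * q * B_ser (q ^ 5) + (c ^ 2 + c ^ 3) * q ^ 2 * C_ser (q ^ 5)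
      - (c + c ^ 4) * q ^ 3 * D_ser (q ^ 5))"
proof -
  define Q where "Q = q ^ 5"
  define P where "P = qpoch_inf Q (Q ^ 5) * qpoch_inf (Q ^ 4) (Q ^ 5)"
  define P' where "P' = qpoch_inf (Q ^ 2) (Q ^ 5) * qpoch_inf (Q ^ 3) (Q ^ 5)"
  define E where "E = qpoch_inf (Q ^ 5) (Q ^ 5)"
  define p where "p = qpoch_inf q q"
  define g1 where "g1 = qpoch_inf (c * q) q * qpoch_inf (c ^ 4 * q) q"
  define g2 where "g2 = qpoch_inf (c ^ 2 * q) q * qpoch_inf (c ^ 3 * q) q"
  have Q0: "Q $ 0 = 0" by (simp add: Q_def q_def)
  have nz: "P $ 0 = 1" "P' $ 0 = 1" "E $ 0 = 1" "g1 $ 0 = 1"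
    unfolding P_def P'_def E_def g1_def fps_mult_nth_0 using Q0
    by (simp_all add: qpoch_tendsto(2) fps_nth_power_0 q_def)
  hence nz': "P \<noteq> 0" "P' \<noteq> 0" "E \<noteq> 0" "g1 \<noteq> 0" by auto
  have "fps_const (1 + z + z ^ 2 + z ^ 3 + z ^ 4) = 0"
    using sum_powers_root_5[OF z] by simp
  hence c: "1 + c + c ^ 2 + c ^ 3 + c ^ 4 = 0"
    by (simp add: c_def fps_const_power flip: fps_const_add)
  have c5: "c ^ 5 = 1" using z by (simp add: c_def fps_const_power)
  have z2: "(z ^ 2) ^ 5 = 1" "z ^ 2 \<noteq> 1"
  proof -
    show "(z ^ 2) ^ 5 = 1" using z(1) by (metis mult.commute power_mult power_one)
    show "z ^ 2 \<noteq> 1"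
    proof
      assume *: "z ^ 2 = 1"
      have "z ^ 5 = (z ^ 2) ^ 2 * z" by (simp add: power_numeral_reduce)
      thus False using z * by simp
    qed
  qed
  have zp: "(z ^ 2) ^ 4 = z ^ 3" "(z ^ 2) ^ 2 = z ^ 4" "(z ^ 2) ^ 3 = z"
    using power_mod_5[OF z(1), of 8] power_mod_5[OF z(1), of 6] by (simp_all flip: power_mult)
  have 1: "p * g1 = E * (P' + (c ^ 2 + c ^ 3) * q * P)"
    using triple_product_root_5[OF z]
    unfolding p_def g1_def E_def P_def P'_def Q_def q_def c_def fps_const_power
    by (simp add: algebra_simps flip: fps_const_add)
  \<comment> \<open>The same identity at z^2, where the coefficient (z^2)^2 + (z^2)^3 becomes z^4 +
    z.\<close>
  have 2: "p * g2 = E * (P' + (c + c ^ 4) * q * P)"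
    using triple_product_root_5[OF z2]
    unfolding p_def g2_def E_def P_def P'_def Q_def q_def c_def fps_const_power zp
    by (simp add: algebra_simps flip: fps_const_add)
  have 3: "p * g1 * g2 = P * P' * E"
    using qpoch_inf_roots_5[OF z] qpoch_inf_residues_5[OF Q0]
    unfolding p_def g1_def g2_def E_def P_def P'_def Q_def q_def c_def fps_const_power
    by (simp add: mult_ac)
  have ABCD: "A_ser Q * P ^ 2 = P' * E" "B_ser Q * P = E" "C_ser Q * P' = E" "D_ser Q * P' ^ 2 = P * E"
  proof -
    have sq: "P ^ 2 $ 0 \<noteq> 0" "P' ^ 2 $ 0 \<noteq> 0" using nz by (simp_all add: fps_nth_power_0)
    have "A_ser Q = P' * E / P ^ 2" "B_ser Q = E / P" "C_ser Q = E / P'" "D_ser Q = P * E / P' ^ 2"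
      unfolding A_ser_def B_ser_def C_ser_def D_ser_def qpochs_inf_def P_def P'_def E_def
      by (simp_all add: mult_ac)
    thus "A_ser Q * P ^ 2 = P' * E" "B_ser Q * P = E" "C_ser Q * P' = E" "D_ser Q * P' ^ 2 = P * E"
      using sq nz by (metis fps_divide_iff zero_neq_one)+
  qed
  \<comment> \<open>The two coefficients are the roots \<open>x\<close> and \<open>- 1 - x\<close>
    of X^2 + X - 1, so the expansion of the cube needs only \<open>x ^ 2 = 1 - x\<close>.\<close>
  define x where "x = c + c ^ 4"
  have x: "c ^ 2 + c ^ 3 = - 1 - x" "x ^ 2 = 1 - x"
    unfolding x_def using c c5 by algebra+
  \<comment> \<open>Both sides are p (p g1 g2)^2. This replaces the quotient p / g1 by the product
    (p g2)^2 (p g1), whose factors are known.\<close>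
  have "p * (P * P') ^ 2 * E ^ 2 = g1 * (p * g2) ^ 2 * (p * g1)"
  proof -
    have "p * (P * P') ^ 2 * E ^ 2 = p * (P * P' * E) ^ 2" by (simp add: power_mult_distrib mult_ac)
    also have "\<dots> = g1 * (p * g2) ^ 2 * (p * g1)"
      unfolding 3 [symmetric] by (simp add: power2_eq_square mult_ac)
    finally show ?thesis .
  qed
  also have "\<dots> = E ^ 2 * (g1 * E * ((P' + x * q * P) ^ 2 * (P' + (- 1 - x) * q * P)))"
    unfolding 1 2 x x_def [symmetric] by (simp add: power_mult_distrib power2_eq_square mult_ac)
  finally have "p * (P * P') ^ 2 = g1 * E * ((P' + x * q * P) ^ 2 * (P' + (- 1 - x) * q * P))"
    using nz' by (simp add: mult.commute)
  also have "(P' + x * q * P) ^ 2 * (P' + (- 1 - x) * q * P) =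
    P' ^ 3 + (x - 1) * q * P * P' ^ 2 + (- 1 - x) * q ^ 2 * P ^ 2 * P' - x * q ^ 3 * P ^ 3"
    using x(2) by algebra
  also have "g1 * E * \<dots> = g1 * (A_ser Q + (x - 1) * q * B_ser Q + (- 1 - x) * q ^ 2 * C_ser Q - x * q ^ 3 * D_ser Q) * (P * P') ^ 2"
  proof -
    have "E * P' ^ 3 = A_ser Q * (P * P') ^ 2" "E * (P * P' ^ 2) = B_ser Q * (P * P') ^ 2"
      "E * (P ^ 2 * P') = C_ser Q * (P * P') ^ 2" "E * P ^ 3 = D_ser Q * (P * P') ^ 2"
      using ABCD by algebra+
    thus ?thesis by algebra
  qed
  finally have "p = g1 * (A_ser Q + (x - 1) * q * B_ser Q + (- 1 - x) * q ^ 2 * C_ser Q - x * q ^ 3 * D_ser Q)"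
    using nz' by simp
  thus ?thesis unfolding x(1) by (simp add: p_def g1_def Q_def x_def)
qed

section \<open>Partitions with a prescribed number of ones\<close>

text \<open>Bounding the parts by K makes the generating function the inverse of a finite product;
  for n \<le> K the bound excludes nothing.\<close>

definition bounded_partitions :: "nat \<Rightarrow> nat \<Rightarrow> nat multiset set" where
  "bounded_partitions K n = {\<pi> \<in> partitions_of n. set_mset \<pi> \<subseteq> {..K}}"

lemma finite_bounded_partitions [simp]: "finite (bounded_partitions K n)"
  by (simp add: bounded_partitions_def finite_partitions_of)

lemma part_le_partitions_of: "\<pi> \<in> partitions_of n \<Longrightarrow> x \<in># \<pi> \<Longrightarrow> x \<le> n"
  by (auto simp: partitions_of_def dest!: multi_member_split)

lemma bounded_partitions_eq: "n \<le> K \<Longrightarrow> bounded_partitions K n = partitions_of n"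
  using part_le_partitions_of by (fastforce simp: bounded_partitions_def)

lemma bounded_partitions_0: "bounded_partitions 0 n = (if n = 0 then {{#}} else {})"
proof -
  have "\<pi> = {#}" if "\<pi> \<in> bounded_partitions 0 n" for \<pi>
  proof (rule ccontr)
    assume "\<pi> \<noteq> {#}"
    then obtain x where "x \<in># \<pi>" by blast
    with that show False by (auto simp: bounded_partitions_def partitions_of_def)
  qed
  hence "bounded_partitions 0 n \<subseteq> {{#}}" by blast
  moreover have "{#} \<in> bounded_partitions 0 n \<longleftrightarrow> n = 0"
    by (auto simp: bounded_partitions_def partitions_of_def)
  ultimately show ?thesis by auto
qed

text \<open>Removing one copy of K + 1 may leave further copies, so the bound on the rest stays K +
  1. In the generating function this yields a factor 1 / (1 - w q^(K + 1)).\<close>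

lemma bounded_partitions_Suc:
  "bounded_partitions (Suc K) n = bounded_partitions K n \<union>
     (if Suc K \<le> n then add_mset (Suc K) ` bounded_partitions (Suc K) (n - Suc K) else {})"
proof (intro equalityI subsetI)
  fix \<pi> assume \<pi>: "\<pi> \<in> bounded_partitions (Suc K) n"
  show "\<pi> \<in> bounded_partitions K n \<union>
     (if Suc K \<le> n then add_mset (Suc K) ` bounded_partitions (Suc K) (n - Suc K) else {})"
  proof (cases "Suc K \<in># \<pi>")
    case True
    then obtain \<rho> where "\<pi> = add_mset (Suc K) \<rho>" by (metis multi_member_split)
    with \<pi> show ?thesis by (auto simp: bounded_partitions_def partitions_of_def)
  next
    case False
    hence "set_mset \<pi> \<subseteq> {..K}" using \<pi>
      by (auto simp: bounded_partitions_def) (metis atMost_iff le_SucE subsetD)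
    thus ?thesis using \<pi> by (simp add: bounded_partitions_def)
  qed
qed (auto simp: bounded_partitions_def partitions_of_def split: if_splits)

definition weighted_partitions :: "(nat \<Rightarrow> 'a::field) \<Rightarrow> nat \<Rightarrow> nat \<Rightarrow> 'a" where
  "weighted_partitions w K n = (\<Sum>\<pi>\<in>bounded_partitions K n. \<Prod>x\<in>#\<pi>. w x)"

lemma weighted_partitions_Suc:
  "weighted_partitions w (Suc K) n = weighted_partitions w K n +
     (if Suc K \<le> n then w (Suc K) * weighted_partitions w (Suc K) (n - Suc K) else 0)"
proof (cases "Suc K \<le> n")
  case True
  have "bounded_partitions K n \<inter> add_mset (Suc K) ` bounded_partitions (Suc K) (n - Suc K) = {}"
    by (auto simp: bounded_partitions_def)
  moreover have "inj_on (add_mset (Suc K)) (bounded_partitions (Suc K) (n - Suc K))"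
    by (rule inj_onI) simp
  ultimately show ?thesis using True unfolding weighted_partitions_def
    by (subst bounded_partitions_Suc) (simp add: sum.union_disjoint sum.reindex sum_distrib_left)
next
  case False
  thus ?thesis unfolding weighted_partitions_def by (subst bounded_partitions_Suc) simp
qed

lemma weighted_partitions_gf_aux:
  "Abs_fps (weighted_partitions w K) * (\<Prod>k\<in>{1..K}. 1 - fps_const (w k) * fps_X ^ k) = 1"
proof (induction K)
  case 0
  show ?case by (auto simp: fps_eq_iff weighted_partitions_def bounded_partitions_0)
next
  case (Suc K)
  have "Abs_fps (weighted_partitions w (Suc K)) * (1 - fps_const (w (Suc K)) * fps_X ^ Suc K) =
    Abs_fps (weighted_partitions w K)"
  proof (rule fps_ext)
    fix n
    have "(Abs_fps (weighted_partitions w (Suc K)) * (1 - fps_const (w (Suc K)) * fps_X ^ Suc K)) $ n =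
      (Abs_fps (weighted_partitions w (Suc K)) - fps_const (w (Suc K)) * (fps_X ^ Suc K * Abs_fps (weighted_partitions w (Suc K)))) $ n"
      by (simp add: algebra_simps)
    also have "\<dots> = weighted_partitions w K n"
      by (subst fps_sub_nth, subst fps_mult_left_const_nth, subst fps_X_power_mult_nth)
         (use weighted_partitions_Suc[of w K n] in auto)
    finally show "(Abs_fps (weighted_partitions w (Suc K)) * (1 - fps_const (w (Suc K)) * fps_X ^ Suc K)) $ n =
      Abs_fps (weighted_partitions w K) $ n" by simp
  qed
  moreover have "(\<Prod>k\<in>{1..Suc K}. 1 - fps_const (w k) * fps_X ^ k) =
    (1 - fps_const (w (Suc K)) * fps_X ^ Suc K) * (\<Prod>k\<in>{1..K}. 1 - fps_const (w k) * fps_X ^ k)"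
    by (rule prod.nat_ivl_Suc') simp
  ultimately show ?case using Suc.IH by (simp only: mult.assoc [symmetric])
qed

lemma weighted_partitions_gf:
  fixes w :: "nat \<Rightarrow> 'a::field"
  assumes "n \<le> K"
  shows "(\<Sum>\<pi>\<in>partitions_of n. \<Prod>x\<in>#\<pi>. w x) = inverse (\<Prod>k\<in>{1..K}. 1 - fps_const (w k) * fps_X ^ k) $ n"
proof -
  have "inverse (\<Prod>k\<in>{1..K}. 1 - fps_const (w k) * fps_X ^ k) = Abs_fps (weighted_partitions w K)"
    using fps_inverse_unique[OF weighted_partitions_gf_aux[of w K]]
      fps_inverse_unique[of "\<Prod>k\<in>{1..K}. 1 - fps_const (w k) * fps_X ^ k" "Abs_fps (weighted_partitions w K)"]
      weighted_partitions_gf_aux[of w K] by (simp add: mult.commute)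
  thus ?thesis by (simp add: weighted_partitions_def bounded_partitions_eq[OF assms])
qed

text \<open>The weight \<open>0\<close> of a part \<open>1\<close> restricts the sum to partitions without ones; the \<open>j\<close> ones are
  added back afterwards.\<close>
definition crank_weight :: "'a::field \<Rightarrow> nat \<Rightarrow> nat \<Rightarrow> 'a" where
  "crank_weight z j x = (if x = 1 then 0 else if x \<le> j then 1 else z)"

lemma prod_crank_weight:
  "(\<Prod>x\<in>#\<pi>. crank_weight z j x) = (if 1 \<in># \<pi> then 0 else z ^ size {#x \<in># \<pi>. x > j#})"
  by (induction \<pi>) (auto simp: crank_weight_def)

text \<open>Deleting the j ones is a bijection onto the partitions of n - j without ones. As j \<ge>
  1, a part 1 never exceeds j, so \<open>mu\<close> is unchanged when counted on the remaining
  parts.\<close>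

lemma sum_crank_fixed_ones:
  fixes z :: "'a::field"
  assumes "1 \<le> j" "j \<le> n" "n \<le> K"
  shows "(\<Sum>\<pi> | \<pi> \<in> partitions_of n \<and> ones \<pi> = j. z ^ mu \<pi>) =
    inverse (\<Prod>k\<in>{1..K}. 1 - fps_const (crank_weight z j k) * fps_X ^ k) $ (n - j)"
proof -
  have "(\<Sum>\<pi> | \<pi> \<in> partitions_of n \<and> ones \<pi> = j. z ^ mu \<pi>) =
    (\<Sum>\<pi> | \<pi> \<in> partitions_of (n - j) \<and> 1 \<notin># \<pi>. z ^ size {#x \<in># \<pi>. x > j#})"
  proof (rule sum.reindex_bij_witness[of _ "\<lambda>\<pi>. \<pi> + replicate_mset j 1" "\<lambda>\<pi>. \<pi> - replicate_mset j 1"])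
    fix \<pi> assume "\<pi> \<in> {\<pi>. \<pi> \<in> partitions_of n \<and> ones \<pi> = j}"
    hence \<pi>: "0 \<notin># \<pi>" "sum_mset \<pi> = n" "count \<pi> 1 = j" by (auto simp: partitions_of_def ones_def)
    hence "replicate_mset j 1 \<subseteq># \<pi>" by (simp flip: count_le_replicate_mset_subset_eq)
    then obtain \<rho> where \<rho>: "\<pi> = \<rho> + replicate_mset j 1" by (metis subset_mset.diff_add)
    have "count \<rho> 1 = 0" using \<pi>(3) \<rho> by simp
    hence 1: "1 \<notin># \<rho>" by (simp add: not_in_iff)
    show "\<pi> - replicate_mset j 1 + replicate_mset j 1 = \<pi>" by (simp add: \<rho>)
    show "\<pi> - replicate_mset j 1 \<in> {\<pi>. \<pi> \<in> partitions_of (n - j) \<and> 1 \<notin># \<pi>}"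
      using \<pi> 1 by (auto simp: \<rho> partitions_of_def)
    have e: "{#x \<in># replicate_mset j 1. x > j#} = {#}" using assms(1) by (intro multiset_eqI) auto
    show "z ^ size {#x \<in># \<pi> - replicate_mset j 1. x > j#} = z ^ mu \<pi>"
      unfolding mu_def ones_def \<pi>(3) unfolding \<rho>
      by (simp only: filter_union_mset add_diff_cancel_right' e add_0_right)
  next
    fix \<pi> assume "\<pi> \<in> {\<pi>. \<pi> \<in> partitions_of (n - j) \<and> 1 \<notin># \<pi>}"
    thus "\<pi> + replicate_mset j 1 \<in> {\<pi>. \<pi> \<in> partitions_of n \<and> ones \<pi> = j}"
      using assms(2) by (auto simp: partitions_of_def ones_def not_in_iff)
  qed simp
  also have "\<dots> = (\<Sum>\<pi>\<in>partitions_of (n - j). \<Prod>x\<in>#\<pi>. crank_weight z j x)"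
    by (rule sum.mono_neutral_cong_left) (auto simp: prod_crank_weight finite_partitions_of)
  also have "\<dots> = inverse (\<Prod>k\<in>{1..K}. 1 - fps_const (crank_weight z j k) * fps_X ^ k) $ (n - j)"
    by (rule weighted_partitions_gf) (use assms in simp)
  finally show ?thesis .
qed

text \<open>The weights give the factors 1 - q^k for 2 \<le> k \<le> j and 1 - z q^k for j < k \<le>
  K. The product is thus (q;q)_j (zq;q)_K / ((1 - q) (zq;q)_j), written here without
  division.\<close>

lemma prod_crank_weight_qpoch:
  fixes z :: "'a::field"
  assumes "1 \<le> j" "j \<le> K"
  shows "(\<Prod>k\<in>{1..K}. 1 - fps_const (crank_weight z j k) * fps_X ^ k) * (1 - fps_X) * qpoch (fps_const z * fps_X) fps_X j =
    qpoch fps_X fps_X j * qpoch (fps_const z * fps_X) fps_X K"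
  using assms(2)
proof (induction K rule: dec_induct)
  case base
  have "(\<Prod>k\<in>{1..i}. 1 - fps_const (crank_weight z j k) * fps_X ^ k) * (1 - fps_X) = qpoch fps_X fps_X i"
    if "1 \<le> i" "i \<le> j" for i
    using that
  proof (induction i rule: dec_induct)
    case (step i)
    thus ?case by (simp add: prod.nat_ivl_Suc' qpoch_Suc crank_weight_def mult_ac)
  qed (simp add: crank_weight_def qpoch_Suc)
  from this[of j] assms(1) show ?case by simp
next
  case (step K)
  have "crank_weight z j (Suc K) = z" using step.hyps assms(1) by (auto simp: crank_weight_def)
  thus ?case using step.IH by (simp add: prod.nat_ivl_Suc' qpoch_Suc mult.assoc)
qed

definition crank_ones_sum :: "complex \<Rightarrow> nat \<Rightarrow> complex" where
  "crank_ones_sum z n = (\<Sum>\<pi>\<in>partitions_of n. of_nat (ones \<pi>) * z powi crank \<pi>)"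

lemma ones_le: "\<pi> \<in> partitions_of n \<Longrightarrow> ones \<pi> \<le> n"
proof -
  assume "\<pi> \<in> partitions_of n"
  hence "sum_mset \<pi> = n" by (simp add: partitions_of_def)
  moreover have "count \<pi> 1 \<le> sum_mset \<pi>"
    by (induction \<pi>) auto
  ultimately show ?thesis by (simp add: ones_def)
qed

lemma crank_ones_sum_by_ones:
  assumes "z \<noteq> 0"
  shows "crank_ones_sum z n = (\<Sum>j\<in>{1..n}. of_nat j * inverse z ^ j * (\<Sum>\<pi> | \<pi> \<in> partitions_of n \<and> ones \<pi> = j. z ^ mu \<pi>))"
proof -
  \<comment> \<open>Partitions without ones carry weight 0; on all others the crank is
    \<open>mu\<close> minus the number of ones.\<close>
  have "crank_ones_sum z n = (\<Sum>\<pi> | \<pi> \<in> partitions_of n \<and> ones \<pi> \<in> {1..n}. of_nat (ones \<pi>) * z powi crank \<pi>)"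
    unfolding crank_ones_sum_def
    by (rule sum.mono_neutral_right) (auto simp: finite_partitions_of ones_le Suc_le_eq)
  also have "\<dots> = (\<Sum>j\<in>{1..n}. \<Sum>\<pi> | \<pi> \<in> {\<pi> \<in> partitions_of n. ones \<pi> \<in> {1..n}} \<and> ones \<pi> = j. of_nat (ones \<pi>) * z powi crank \<pi>)"
    by (rule sum.group [symmetric]) (auto simp: finite_partitions_of)
  also have "\<dots> = (\<Sum>j\<in>{1..n}. of_nat j * inverse z ^ j * (\<Sum>\<pi> | \<pi> \<in> partitions_of n \<and> ones \<pi> = j. z ^ mu \<pi>))"
  proof (rule sum.cong)
    fix j assume j: "j \<in> {1..n}"
    have "(\<Sum>\<pi> | \<pi> \<in> {\<pi> \<in> partitions_of n. ones \<pi> \<in> {1..n}} \<and> ones \<pi> = j. of_nat (ones \<pi>) * z powi crank \<pi>) =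
      (\<Sum>\<pi> | \<pi> \<in> partitions_of n \<and> ones \<pi> = j. of_nat j * inverse z ^ j * z ^ mu \<pi>)"
    proof (rule sum.cong)
      fix \<pi> assume "\<pi> \<in> {\<pi>. \<pi> \<in> partitions_of n \<and> ones \<pi> = j}"
      thus "of_nat (ones \<pi>) * z powi crank \<pi> = of_nat j * inverse z ^ j * z ^ mu \<pi>"
        using j assms by (simp add: crank_def power_int_diff power_int_of_nat field_simps)
    qed (use j in auto)
    thus "(\<Sum>\<pi> | \<pi> \<in> {\<pi> \<in> partitions_of n. ones \<pi> \<in> {1..n}} \<and> ones \<pi> = j. of_nat (ones \<pi>) * z powi crank \<pi>) =
      of_nat j * inverse z ^ j * (\<Sum>\<pi> | \<pi> \<in> partitions_of n \<and> ones \<pi> = j. z ^ mu \<pi>)"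
      by (simp add: sum_distrib_left)
  qed simp
  finally show ?thesis .
qed

text \<open>The coefficients of the q-binomial series with sum (z q u;q) / (u;q), evaluated below at
  u = q / z.\<close>

definition crank_coeff :: "complex \<Rightarrow> nat \<Rightarrow> complex fps" where
  "crank_coeff z j = qpoch (fps_const z * fps_X) fps_X j * inverse (qpoch fps_X fps_X j)"

text \<open>Modulo q^N only j < N and parts up to N count, so one bound K = N serves every j. The
  factor (1 - q) / (zq;q)_N is then common to all j, and what remains is the q-binomial
  coefficient.\<close>

lemma crank_ones_gf_cong:
  assumes z: "z \<noteq> 0"
  defines "u \<equiv> fps_const (inverse z) * fps_X"
  shows "fps_cong N (Abs_fps (crank_ones_sum z))
    ((1 - fps_X) * inverse (qpoch (fps_const z * fps_X) fps_X N) * (\<Sum>j<N. of_nat j * crank_coeff z j * u ^ j))"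
proof -
  define D where "D = (\<lambda>j. \<Prod>k\<in>{1..N}. 1 - fps_const (crank_weight z j k) * fps_X ^ k :: complex fps)"
  define I where "I = inverse (qpoch (fps_const z * fps_X) fps_X N)"
  have D: "inverse (D j) = (1 - fps_X) * I * crank_coeff z j" if "1 \<le> j" "j \<le> N" for j
  proof -
    have 1: "D j * (1 - fps_X) * qpoch (fps_const z * fps_X) fps_X j = qpoch fps_X fps_X j * qpoch (fps_const z * fps_X) fps_X N"
      unfolding D_def by (rule prod_crank_weight_qpoch[OF that])
    have 2: "inverse (qpoch fps_X fps_X j) * qpoch fps_X fps_X j = (1 :: complex fps)"
      by (rule inverse_mult_eq_1) (simp add: qpoch_fps_nth_0)
    have 3: "I * qpoch (fps_const z * fps_X) fps_X N = 1"
      unfolding I_def by (rule inverse_mult_eq_1) (simp add: qpoch_fps_nth_0)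
    have "D j * ((1 - fps_X) * I * crank_coeff z j) =
      I * inverse (qpoch fps_X fps_X j) * (D j * (1 - fps_X) * qpoch (fps_const z * fps_X) fps_X j)"
      by (simp add: crank_coeff_def mult_ac)
    also have "\<dots> = (I * qpoch (fps_const z * fps_X) fps_X N) * (inverse (qpoch fps_X fps_X j) * qpoch fps_X fps_X j)"
      unfolding 1 by (simp only: mult_ac)
    finally have "D j * ((1 - fps_X) * I * crank_coeff z j) = 1" unfolding 2 3 by simp
    thus ?thesis by (rule fps_inverse_unique)
  qed
  have u: "u ^ j = fps_const (inverse z ^ j) * fps_X ^ j" for j
    by (simp add: u_def power_mult_distrib fps_const_power)
  have "fps_cong N (Abs_fps (crank_ones_sum z)) (\<Sum>j\<in>{1..<N}. of_nat j * u ^ j * inverse (D j))"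
    unfolding fps_cong_iff
  proof (intro allI impI)
    fix n assume n: "n < N"
    have "crank_ones_sum z n = (\<Sum>j\<in>{1..n}. of_nat j * inverse z ^ j * inverse (D j) $ (n - j))"
      unfolding crank_ones_sum_by_ones[OF z] D_def using n
      by (intro sum.cong refl arg_cong2[of _ _ _ _ "(*)"] sum_crank_fixed_ones) auto
    also have "\<dots> = (\<Sum>j\<in>{1..<N}. if j \<le> n then of_nat j * inverse z ^ j * inverse (D j) $ (n - j) else 0)"
      using n by (intro sum.mono_neutral_cong_left) auto
    also have "\<dots> = (\<Sum>j\<in>{1..<N}. (of_nat j * u ^ j * inverse (D j)) $ n)"
    proof (rule sum.cong)
      fix j
      have "of_nat j * u ^ j * inverse (D j) = fps_const (of_nat j * inverse z ^ j) * (fps_X ^ j * inverse (D j))"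
        by (simp add: u fps_of_nat mult_ac flip: fps_const_mult)
      thus "(if j \<le> n then of_nat j * inverse z ^ j * inverse (D j) $ (n - j) else 0) = (of_nat j * u ^ j * inverse (D j)) $ n"
        by (simp only: fps_mult_left_const_nth fps_X_power_mult_nth) simp
    qed simp
    finally show "Abs_fps (crank_ones_sum z) $ n = (\<Sum>j\<in>{1..<N}. of_nat j * u ^ j * inverse (D j)) $ n"
      by (simp add: fps_sum_nth)
  qed
  also have "(\<Sum>j\<in>{1..<N}. of_nat j * u ^ j * inverse (D j)) = (\<Sum>j\<in>{1..<N}. (1 - fps_X) * I * (of_nat j * crank_coeff z j * u ^ j))"
    by (intro sum.cong) (auto simp: D mult_ac)
  \<comment> \<open>The added term j = 0 vanishes because of its factor
    \<open>of_nat j\<close>.\<close>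
  also have "\<dots> = (\<Sum>j<N. (1 - fps_X) * I * (of_nat j * crank_coeff z j * u ^ j))"
    by (rule sum.mono_neutral_left) auto
  also have "\<dots> = (1 - fps_X) * I * (\<Sum>j<N. of_nat j * crank_coeff z j * u ^ j)"
    by (rule sum_distrib_left [symmetric])
  finally show ?thesis unfolding I_def .
qed

section \<open>The generating function of the crank weighted by ones\<close>

lemma fps_cong_sum_shift:
  fixes f :: "nat \<Rightarrow> 'a::field fps"
  assumes "f 0 = 0" "fps_X ^ N dvd f N"
  shows "fps_cong N (\<Sum>j<N. f j) (\<Sum>j<N. f (Suc j))"
proof -
  have "(\<Sum>j<N. f j) + f N = (\<Sum>j<N. f (Suc j))"
    using sum.lessThan_Suc_shift[of f N] assms(1) by simp
  hence "(\<Sum>j<N. f j) - (\<Sum>j<N. f (Suc j)) = - f N" by (simp add: algebra_simps)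
  thus ?thesis using assms(2) by (simp add: fps_cong_def)
qed

text \<open>Writing \<open>G u = (\<Sum>j. c j * u ^ j)\<close> and \<open>H u = u * G' u\<close>, the recurrence for \<open>c\<close> gives
  \<open>(1 - u) G(u) = (1 - a u) G(q u)\<close>, and the same equation differentiated relates \<open>H(u)\<close> to \<open>H(q u)\<close>.
  Iterating both replaces the logarithmic derivative of the q-binomial theorem, and working modulo
  \<open>q^N\<close> keeps all sums finite.\<close>
lemma qbinomial_log_derivative:
  fixes c :: "nat \<Rightarrow> 'a::field fps" and a b :: "'a fps"
  assumes c0: "c 0 = 1" and c: "\<And>j. c (Suc j) * (1 - fps_X ^ Suc j) = c j * (1 - a * fps_X ^ j)"
    and b0: "b $ 0 = 0"
  defines "u \<equiv> \<lambda>k. b * fps_X ^ k"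
  defines "r \<equiv> \<lambda>k. (1 - a * u k) * inverse (1 - u k)"
    and "s \<equiv> \<lambda>k. u k * inverse (1 - u k) - a * u k * inverse (1 - a * u k)"
  shows "fps_cong N (\<Sum>j<N. of_nat j * c j * b ^ j) ((\<Prod>k<N. r k) * (\<Sum>k<N. s k))"
proof (cases "N = 0")
  case False
  define G where "G = (\<lambda>k. \<Sum>j<N. c j * u k ^ j)"
  define H where "H = (\<lambda>k. \<Sum>j<N. of_nat j * c j * u k ^ j)"
  have u0: "u k $ 0 = 0" for k by (simp add: u_def b0)
  have dvd: "fps_X ^ N dvd h * u k ^ N" for h k
    using fps_X_power_dvd_power[OF u0] by (rule dvd_mult)
  have uS: "u (Suc k) ^ j = fps_X ^ j * u k ^ j" for k j
    by (simp add: u_def power_mult_distrib mult_ac)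
  have G: "fps_cong N ((1 - u k) * G k) ((1 - a * u k) * G (Suc k))" for k
  proof -
    \<comment> \<open>The sum of \<open>f\<close> is evaluated twice: as it stands it is G(k) - G(k
      + 1), and after an index shift the recurrence for \<open>c\<close> applies. The shift costs
      one multiple of u_k^N, which is 0 modulo q^N.\<close>
    define f where "f = (\<lambda>j. c j * (1 - fps_X ^ j) * u k ^ j)"
    have "f (Suc j) = u k * (c j * u k ^ j - a * (c j * u (Suc k) ^ j))" for j
      unfolding f_def c uS by (simp add: algebra_simps)
    hence "(\<Sum>j<N. f (Suc j)) = u k * (G k - a * G (Suc k))"
      by (simp only: G_def sum_distrib_left sum_subtractf right_diff_distrib)
    moreover have "(\<Sum>j<N. f j) = G k - G (Suc k)"
      by (simp add: G_def f_def uS algebra_simps sum_subtractf)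
    moreover have "fps_cong N (\<Sum>j<N. f j) (\<Sum>j<N. f (Suc j))"
      by (rule fps_cong_sum_shift) (simp_all add: f_def dvd)
    ultimately have "fps_X ^ N dvd (G k - G (Suc k)) - u k * (G k - a * G (Suc k))"
      by (simp add: fps_cong_def)
    thus ?thesis by (simp add: fps_cong_def algebra_simps)
  qed
  have H: "fps_cong N ((1 - u k) * H k) ((1 - a * u k) * H (Suc k) + (u k * G k - a * u k * G (Suc k)))" for k
  proof -
    \<comment> \<open>Here the shift turns the factor j into j + 1; the extra 1 produces the terms
      with \<open>G\<close>, as the product rule would.\<close>
    define f where "f = (\<lambda>j. of_nat j * (c j * (1 - fps_X ^ j)) * u k ^ j)"
    have "f (Suc j) = u k * (of_nat j * c j * u k ^ j + c j * u k ^ j - a * (of_nat j * c j * u (Suc k) ^ j + c j * u (Suc k) ^ j))" for j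
      unfolding f_def c uS by (simp add: algebra_simps)
    hence "(\<Sum>j<N. f (Suc j)) = u k * (H k + G k - a * (H (Suc k) + G (Suc k)))"
      by (simp only: G_def H_def sum_distrib_left sum_subtractf sum.distrib distrib_left right_diff_distrib)
    moreover have "(\<Sum>j<N. f j) = H k - H (Suc k)"
      by (simp add: H_def f_def uS algebra_simps sum_subtractf)
    moreover have "fps_cong N (\<Sum>j<N. f j) (\<Sum>j<N. f (Suc j))"
      by (rule fps_cong_sum_shift) (simp_all add: f_def dvd)
    ultimately have "fps_X ^ N dvd (H k - H (Suc k)) - u k * (H k + G k - a * (H (Suc k) + G (Suc k)))"
      by (simp add: fps_cong_def)
    thus ?thesis by (simp add: fps_cong_def algebra_simps)
  qed
  have iu: "inverse (1 - u k) * (1 - u k) = 1" for k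
    by (rule inverse_mult_eq_1) (simp add: u0)
  have ia: "inverse (1 - a * u k) * (1 - a * u k) = 1" for k
    by (rule inverse_mult_eq_1) (simp add: u0)
  have G': "fps_cong N (G k) (r k * G (Suc k))" for k
  proof -
    have "fps_cong N (inverse (1 - u k) * ((1 - u k) * G k)) (inverse (1 - u k) * ((1 - a * u k) * G (Suc k)))"
      by (rule fps_cong_mult[OF fps_cong_refl G])
    thus ?thesis unfolding r_def mult.assoc [symmetric] iu by (simp add: mult_ac)
  qed
  have H': "fps_cong N (H k) (r k * H (Suc k) + s k * G k)" for k
  proof -
    \<comment> \<open>Eliminating G(k + 1) in favour of G(k) turns the inhomogeneous part of the
      equation for \<open>H\<close> into s_k G(k).\<close>
    have "fps_cong N (inverse (1 - a * u k) * ((1 - u k) * G k)) (inverse (1 - a * u k) * ((1 - a * u k) * G (Suc k)))"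
      by (rule fps_cong_mult[OF fps_cong_refl G])
    hence GS: "fps_cong N (inverse (1 - a * u k) * ((1 - u k) * G k)) (G (Suc k))"
      unfolding mult.assoc [symmetric] ia by simp
    have "fps_cong N (inverse (1 - u k) * ((1 - u k) * H k))
      (inverse (1 - u k) * ((1 - a * u k) * H (Suc k) + (u k * G k - a * u k * G (Suc k))))"
      by (rule fps_cong_mult[OF fps_cong_refl H])
    hence "fps_cong N (H k)
      (inverse (1 - u k) * ((1 - a * u k) * H (Suc k) + (u k * G k - a * u k * G (Suc k))))"
      unfolding mult.assoc [symmetric] iu by simp
    also have "fps_cong N \<dots> (inverse (1 - u k) * ((1 - a * u k) * H (Suc k) + (u k * G k - a * u k * (inverse (1 - a * u k) * ((1 - u k) * G k)))))"
      by (intro fps_cong_mult fps_cong_add fps_cong_diff fps_cong_refl fps_cong_sym[OF GS])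
    also have "\<dots> = r k * H (Suc k) + s k * G k"
    proof -
      have "inverse (1 - u k) * ((1 - a * u k) * H (Suc k) + (u k * G k - a * u k * (inverse (1 - a * u k) * ((1 - u k) * G k)))) =
        r k * H (Suc k) + (u k * inverse (1 - u k) - a * u k * inverse (1 - a * u k) * (inverse (1 - u k) * (1 - u k))) * G k"
        by (simp add: r_def algebra_simps)
      thus ?thesis by (simp only: iu s_def mult_1_right)
    qed
    finally show ?thesis .
  qed
  \<comment> \<open>Each new s_n arrives multiplied by r_0 ... r_(n-1) G(n), which is again G(0); so
    the s_n simply add up.\<close>
  have iter: "fps_cong N (G 0) (prod r {..<n} * G n) \<and>
    fps_cong N (H 0) (prod r {..<n} * H n + sum s {..<n} * G 0)" for n
  proof (induction n)
    case (Suc n)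
    have "fps_cong N (prod r {..<n} * G n) (prod r {..<n} * (r n * G (Suc n)))"
      by (intro fps_cong_mult fps_cong_refl G')
    with Suc.IH have 1: "fps_cong N (G 0) (prod r {..<Suc n} * G (Suc n))"
      by (simp add: mult.assoc) (blast intro: fps_cong_trans)
    have "fps_cong N (prod r {..<n} * H n + sum s {..<n} * G 0)
      (prod r {..<n} * (r n * H (Suc n) + s n * G n) + sum s {..<n} * G 0)"
      by (intro fps_cong_mult fps_cong_add fps_cong_refl H')
    also have "\<dots> = prod r {..<Suc n} * H (Suc n) + s n * (prod r {..<n} * G n) + sum s {..<n} * G 0"
      by (simp add: algebra_simps)
    also have "fps_cong N \<dots> (prod r {..<Suc n} * H (Suc n) + s n * G 0 + sum s {..<n} * G 0)"
      using Suc.IH by (intro fps_cong_mult fps_cong_add fps_cong_refl) (simp add: fps_cong_sym)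
    also have "\<dots> = prod r {..<Suc n} * H (Suc n) + sum s {..<Suc n} * G 0"
      by (simp add: algebra_simps)
    finally show ?case using 1 Suc.IH fps_cong_trans by blast
  qed simp
  \<comment> \<open>After N steps the argument is 0 modulo q^N, so only the terms j = 0 survive: 1
    in \<open>G\<close> and 0 in \<open>H\<close>.\<close>
  have X_dvd_u: "fps_X ^ N dvd u N" by (simp add: u_def)
  hence tail: "fps_X ^ N dvd u N ^ Suc j" for j by (simp add: dvd_mult2)
  have GN: "fps_cong N (G N) 1"
  proof -
    obtain M where M: "N = Suc M" using False by (cases N) auto
    have "G N = c 0 * u N ^ 0 + (\<Sum>j<M. c (Suc j) * u N ^ Suc j)"
      unfolding G_def using sum.lessThan_Suc_shift[of "\<lambda>j. c j * u N ^ j" M] by (simp add: M)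
    moreover have "fps_X ^ N dvd (\<Sum>j<M. c (Suc j) * u N ^ Suc j)"
      by (intro dvd_sum dvd_mult tail)
    ultimately show ?thesis by (simp add: fps_cong_def c0)
  qed
  have HN: "fps_cong N (H N) 0"
    unfolding fps_cong_0_iff H_def
  proof (rule dvd_sum)
    fix j show "fps_X ^ N dvd of_nat j * c j * u N ^ j"
      by (cases j) (simp_all add: dvd_mult tail del: power_Suc)
  qed
  have "fps_cong N (G 0) (prod r {..<N} * 1)"
    using iter[of N] fps_cong_mult[OF fps_cong_refl GN] fps_cong_trans by blast
  moreover have "fps_cong N (H 0) (prod r {..<N} * 0 + sum s {..<N} * G 0)"
    using iter[of N] fps_cong_add[OF fps_cong_mult[OF fps_cong_refl HN] fps_cong_refl] fps_cong_trans by blast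
  ultimately have "fps_cong N (H 0) (prod r {..<N} * 0 + sum s {..<N} * (prod r {..<N} * 1))"
    by (meson fps_cong_add fps_cong_mult fps_cong_refl fps_cong_trans)
  thus ?thesis by (simp add: H_def u_def mult.commute)
qed (simp add: fps_cong_iff)

definition lambert :: "complex \<Rightarrow> complex fps" where
  "lambert w = (\<Sum>n. fps_const w * fps_X ^ Suc n / (1 - fps_const w * fps_X ^ Suc n))"

lemma lambert_tendsto:
  "(\<lambda>N. \<Sum>n<N. fps_const w * fps_X ^ Suc n / (1 - fps_const w * fps_X ^ Suc n)) \<longlonglongrightarrow> lambert w"
  unfolding lambert_def
proof (rule sums_fps)
  fix n
  have "fps_const w * fps_X ^ Suc n / (1 - fps_const w * fps_X ^ Suc n) =
    fps_X ^ n * (fps_const w * fps_X * inverse (1 - fps_const w * fps_X ^ Suc n))"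
    by (subst fps_divide_unit) (simp_all add: mult_ac)
  thus "fps_X ^ n dvd fps_const w * fps_X ^ Suc n / (1 - fps_const w * fps_X ^ Suc n)" by simp
qed

lemma S_ser_tendsto: "(\<lambda>N. \<Sum>n<N. fps_X ^ (Suc n + 1) / (1 - fps_X ^ (Suc n + 1))) \<longlonglongrightarrow> S_ser fps_X"
  unfolding S_ser_def
proof (rule sums_fps)
  fix n
  have "fps_X ^ (Suc n + 1) / (1 - fps_X ^ (Suc n + 1)) =
    (fps_X ^ n * (fps_X ^ 2 * inverse (1 - fps_X ^ (Suc n + 1))) :: complex fps)"
    by (subst fps_divide_unit) (simp_all add: power2_eq_square mult_ac)
  thus "(fps_X :: complex fps) ^ n dvd fps_X ^ (Suc n + 1) / (1 - fps_X ^ (Suc n + 1))" by simp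
qed

text \<open>In the q-binomial series a = z q and b = q / z, so a b = q^2 is free of z: the second
  Lambert sum is S, starting at q^2, and (1 - q) (q^2;q) restores (q;q). The truncations
  \<open>F\<close> tend both to the product side and to the wanted series.\<close>

theorem crank_ones_gf:
  assumes z: "z \<noteq> 0"
  shows "qpoch_inf (fps_const z * fps_X) fps_X * qpoch_inf (fps_const (inverse z) * fps_X) fps_X * Abs_fps (crank_ones_sum z) =
    qpoch_inf fps_X fps_X * (lambert (inverse z) - S_ser fps_X)"
proof -
  define a where "a = fps_const z * fps_X"
  define b where "b = fps_const (inverse z) * fps_X"
  have ab: "a * b = fps_X ^ 2"
    using z by (simp add: a_def b_def power2_eq_square mult_ac flip: mult.assoc)
  have a0: "a $ 0 = 0" "b $ 0 = 0" by (simp_all add: a_def b_def)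
  have abk: "a * (b * fps_X ^ k) = fps_X ^ (Suc k + 1)" for k
    using ab by (simp add: mult.assoc [symmetric] power2_eq_square)
  have bk: "b * fps_X ^ k = fps_const (inverse z) * fps_X ^ Suc k" for k by (simp add: b_def mult.assoc)
  define s where "s = (\<lambda>k. fps_const (inverse z) * fps_X ^ Suc k / (1 - fps_const (inverse z) * fps_X ^ Suc k) -
    fps_X ^ (Suc k + 1) / (1 - fps_X ^ (Suc k + 1)))"
  define F where "F = (\<lambda>N. (1 - fps_X) * inverse (qpoch a fps_X N) * (qpoch (fps_X ^ 2) fps_X N * inverse (qpoch b fps_X N) * (\<Sum>k<N. s k)))"
  have F: "fps_cong N (Abs_fps (crank_ones_sum z)) (F N)" for N
  proof -
    have "crank_coeff z (Suc j) * (1 - fps_X ^ Suc j) = crank_coeff z j * (1 - a * fps_X ^ j)" for j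
    proof -
      have "inverse (1 - fps_X ^ Suc j :: complex fps) * (1 - fps_X ^ Suc j) = 1"
        by (rule inverse_mult_eq_1) simp
      moreover have "crank_coeff z (Suc j) = crank_coeff z j * (1 - a * fps_X ^ j) * inverse (1 - fps_X ^ Suc j)"
        by (simp add: crank_coeff_def qpoch_Suc fps_inverse_mult a_def)
      ultimately show ?thesis by (simp only: mult.assoc mult_1_right)
    qed
    from qbinomial_log_derivative[of "crank_coeff z" a b, OF _ this a0(2)]
    have "fps_cong N (\<Sum>j<N. of_nat j * crank_coeff z j * b ^ j)
       ((\<Prod>k<N. (1 - a * (b * fps_X ^ k)) * inverse (1 - b * fps_X ^ k)) *
        (\<Sum>k<N. b * fps_X ^ k * inverse (1 - b * fps_X ^ k) - a * (b * fps_X ^ k) * inverse (1 - a * (b * fps_X ^ k))))"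
      by (simp add: crank_coeff_def)
    also have "(\<Prod>k<N. (1 - a * (b * fps_X ^ k)) * inverse (1 - b * fps_X ^ k)) = qpoch (fps_X ^ 2) fps_X N * inverse (qpoch b fps_X N)"
    proof -
      have "inverse (qpoch b fps_X N) = (\<Prod>k<N. inverse (1 - b * fps_X ^ k))"
        by (induction N) (simp_all add: qpoch_Suc fps_inverse_mult)
      thus ?thesis by (simp add: prod.distrib qpoch_def ab flip: mult.assoc)
    qed
    also have "(\<Sum>k<N. b * fps_X ^ k * inverse (1 - b * fps_X ^ k) - a * (b * fps_X ^ k) * inverse (1 - a * (b * fps_X ^ k))) = (\<Sum>k<N. s k)"
    proof (rule sum.cong)
      fix k
      show "b * fps_X ^ k * inverse (1 - b * fps_X ^ k) - a * (b * fps_X ^ k) * inverse (1 - a * (b * fps_X ^ k)) = s k"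
        unfolding abk unfolding bk s_def by (simp add: fps_divide_unit)
    qed simp
    finally have "fps_cong N ((1 - fps_X) * inverse (qpoch a fps_X N) * (\<Sum>j<N. of_nat j * crank_coeff z j * b ^ j)) (F N)"
      unfolding F_def by (intro fps_cong_mult fps_cong_refl)
    moreover have "fps_cong N (Abs_fps (crank_ones_sum z))
       ((1 - fps_X) * inverse (qpoch a fps_X N) * (\<Sum>j<N. of_nat j * crank_coeff z j * b ^ j))"
      using crank_ones_gf_cong[OF z] unfolding a_def b_def .
    ultimately show ?thesis using fps_cong_trans by blast
  qed
  define Pa where "Pa = qpoch_inf a fps_X"
  define Pb where "Pb = qpoch_inf b fps_X"
  have lim: "qpoch a fps_X \<longlonglongrightarrow> Pa" "qpoch b fps_X \<longlonglongrightarrow> Pb"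
    unfolding Pa_def Pb_def using a0 by (auto intro: qpoch_tendsto)
  have nz: "Pa $ 0 \<noteq> 0" "Pb $ 0 \<noteq> 0"
    unfolding Pa_def Pb_def using a0 by (simp_all add: qpoch_tendsto(2))
  have "(\<lambda>N. \<Sum>k<N. s k) \<longlonglongrightarrow> lambert (inverse z) - S_ser fps_X"
    unfolding s_def sum_subtractf by (intro tendsto_diff_fps lambert_tendsto S_ser_tendsto)
  hence "F \<longlonglongrightarrow> (1 - fps_X) * inverse Pa * (qpoch_inf (fps_X ^ 2) fps_X * inverse Pb * (lambert (inverse z) - S_ser fps_X))"
    unfolding F_def using nz lim
    by (intro tendsto_mult_fps tendsto_inverse_fps tendsto_const qpoch_tendsto) auto
  moreover have "F \<longlonglongrightarrow> Abs_fps (crank_ones_sum z)"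
  proof (rule tendsto_fpsI)
    fix n show "eventually (\<lambda>N. F N $ n = Abs_fps (crank_ones_sum z) $ n) sequentially"
      using eventually_gt_at_top[of n] by eventually_elim (use F in \<open>simp add: fps_cong_iff\<close>)
  qed
  ultimately have "Abs_fps (crank_ones_sum z) =
    (1 - fps_X) * inverse Pa * (qpoch_inf (fps_X ^ 2) fps_X * inverse Pb * (lambert (inverse z) - S_ser fps_X))"
    using LIMSEQ_unique by blast
  hence "Pa * Pb * Abs_fps (crank_ones_sum z) =
    (inverse Pa * Pa) * (inverse Pb * Pb) * ((1 - fps_X) * qpoch_inf (fps_X ^ 2) fps_X) * (lambert (inverse z) - S_ser fps_X)"
    by (simp only: mult_ac)
  also have "(1 - fps_X) * qpoch_inf (fps_X ^ 2) fps_X = (qpoch_inf fps_X fps_X :: complex fps)"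
    using qpoch_inf_split_first[of fps_X fps_X] by (simp add: power2_eq_square)
  finally have "Pa * Pb * Abs_fps (crank_ones_sum z) = qpoch_inf fps_X fps_X * (lambert (inverse z) - S_ser fps_X)"
    by (simp only: nz[THEN inverse_mult_eq_1] mult_1)
  thus ?thesis unfolding Pa_def Pb_def a_def b_def .
qed

section \<open>Separation of the residue classes\<close>

lemma R_ser_tendsto:
  assumes "i \<ge> 1"
  shows "(\<lambda>N. \<Sum>n<N. fps_X ^ (Suc n * i) / (1 - fps_X ^ (5 * Suc n))) \<longlonglongrightarrow> R_ser i fps_X"
  unfolding R_ser_def
proof (rule sums_fps)
  fix n
  have "Suc n * i = n + (Suc n * i - n)" using assms by (cases i) auto
  hence "fps_X ^ (Suc n * i) = fps_X ^ n * (fps_X ^ (Suc n * i - n) :: complex fps)"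
    by (metis power_add)
  hence "fps_X ^ (Suc n * i) / (1 - fps_X ^ (5 * Suc n)) =
    fps_X ^ n * (fps_X ^ (Suc n * i - n) * inverse (1 - fps_X ^ (5 * Suc n)) :: complex fps)"
    by (subst fps_divide_unit) (simp_all add: mult.assoc)
  thus "(fps_X :: complex fps) ^ n dvd fps_X ^ (Suc n * i) / (1 - fps_X ^ (5 * Suc n))" by simp
qed

lemma inverse_root_5:
  fixes z :: "'a::field"
  assumes "z ^ 5 = 1"
  shows "inverse z = z ^ 4"
proof (rule inverse_unique)
  show "z * z ^ 4 = 1" using assms by (simp add: power_numeral_reduce mult_ac)
qed

text \<open>For Y = q^n, extend the fraction z^4 Y / (1 - z^4 Y) by the geometric sum in z^4 Y. The
  denominator becomes 1 - Y^5, and Y^i receives the coefficient z^(4 i) = z^(5 - i).\<close>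

lemma lambert_root_5:
  fixes z :: complex
  assumes z: "z ^ 5 = 1"
  defines "c \<equiv> fps_const z"
  shows "lambert (inverse z) = c ^ 4 * R_ser 1 fps_X + c ^ 3 * R_ser 2 fps_X + c ^ 2 * R_ser 3 fps_X + c * R_ser 4 fps_X + R_ser 5 fps_X"
proof -
  note inv = inverse_root_5[OF z]
  have c5: "c ^ 5 = 1" using z by (simp add: c_def fps_const_power)
  have *: "fps_const (inverse z) * fps_X ^ Suc n / (1 - fps_const (inverse z) * fps_X ^ Suc n) =
     c ^ 4 * (fps_X ^ (Suc n * 1) / (1 - fps_X ^ (5 * Suc n))) + c ^ 3 * (fps_X ^ (Suc n * 2) / (1 - fps_X ^ (5 * Suc n))) +
     c ^ 2 * (fps_X ^ (Suc n * 3) / (1 - fps_X ^ (5 * Suc n))) + c * (fps_X ^ (Suc n * 4) / (1 - fps_X ^ (5 * Suc n))) +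
     fps_X ^ (Suc n * 5) / (1 - fps_X ^ (5 * Suc n))" for n
  proof -
    define Y where "Y = (fps_X ^ Suc n :: complex fps)"
    have Y0: "Y $ 0 = 0" by (simp add: Y_def)
    have Y: "fps_X ^ (Suc n * i) = Y ^ i" "fps_X ^ (5 * Suc n) = Y ^ 5" for i
      unfolding Y_def by (simp_all only: power_mult [symmetric] mult.commute)
    define I where "I = inverse (1 - Y ^ 5)"
    have I: "I * (1 - Y ^ 5) = 1" unfolding I_def
      by (rule inverse_mult_eq_1) (simp add: Y0 fps_nth_power_0)
    have div: "x / (1 - Y ^ 5) = x * I" for x
      unfolding I_def by (rule fps_divide_unit) (simp add: Y0 fps_nth_power_0)
    have "c ^ 4 * Y / (1 - c ^ 4 * Y) = (c ^ 4 * Y + c ^ 3 * Y ^ 2 + c ^ 2 * Y ^ 3 + c * Y ^ 4 + Y ^ 5) * I"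
    proof (subst fps_divide_iff)
      show "(1 - c ^ 4 * Y) $ 0 \<noteq> 0" by (simp add: Y0)
      show "c ^ 4 * Y = (c ^ 4 * Y + c ^ 3 * Y ^ 2 + c ^ 2 * Y ^ 3 + c * Y ^ 4 + Y ^ 5) * I * (1 - c ^ 4 * Y)"
        using I c5 by algebra
    qed
    moreover have "fps_const (inverse z) = c ^ 4" by (simp add: inv c_def fps_const_power)
    ultimately show ?thesis unfolding Y Y_def [symmetric] div by (simp add: algebra_simps)
  qed
  have "(\<lambda>N. \<Sum>n<N. fps_const (inverse z) * fps_X ^ Suc n / (1 - fps_const (inverse z) * fps_X ^ Suc n)) \<longlonglongrightarrow>
    c ^ 4 * R_ser 1 fps_X + c ^ 3 * R_ser 2 fps_X + c ^ 2 * R_ser 3 fps_X + c * R_ser 4 fps_X + R_ser 5 fps_X"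
    unfolding * sum.distrib sum_distrib_left [symmetric]
    by (intro tendsto_add_fps tendsto_mult_fps tendsto_const R_ser_tendsto) auto
  from LIMSEQ_unique[OF lambert_tendsto this] show ?thesis .
qed

text \<open>At z = 1 the two sums differ by a shift of the index, so the difference telescopes to
  its first term.\<close>

lemma lambert_1: "lambert 1 - S_ser fps_X = fps_X / (1 - fps_X)"
proof -
  define g :: "nat \<Rightarrow> complex fps" where "g = (\<lambda>n. fps_X ^ Suc n / (1 - fps_X ^ Suc n))"
  have "(\<lambda>N. (\<Sum>n<N. g n) - (\<Sum>n<N. g (Suc n))) \<longlonglongrightarrow> lambert 1 - S_ser fps_X"
    using tendsto_diff_fps[OF lambert_tendsto[of 1] S_ser_tendsto] by (simp add: g_def)
  moreover have "(\<Sum>n<N. g n) - (\<Sum>n<N. g (Suc n)) = g 0 - g N" for N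
    by (simp add: sum_subtractf [symmetric] sum_lessThan_telescope')
  moreover have "(\<lambda>N. g 0 - g N) \<longlonglongrightarrow> g 0 - 0"
  proof (intro tendsto_diff_fps tendsto_const tendsto_fpsI)
    fix n
    have "g N $ n = 0" if "N > n" for N
    proof -
      have "g N = fps_X ^ Suc N * inverse (1 - fps_X ^ Suc N)"
        unfolding g_def by (rule fps_divide_unit) simp
      thus ?thesis using that by (simp only: fps_X_power_mult_nth) simp
    qed
    thus "eventually (\<lambda>N. g N $ n = 0 $ n) sequentially"
      by (intro eventually_mono[OF eventually_gt_at_top[of n]]) simp
  qed
  ultimately have "lambert 1 - S_ser fps_X = g 0 - 0" using LIMSEQ_unique by force
  thus ?thesis by (simp add: g_def)
qed

lemma sum_M_omega_gf:
  fixes z :: complex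
  assumes z: "z ^ 5 = 1"
  shows "(\<Sum>m<5. fps_const z ^ m * M_omega_gf (int m) 5) = Abs_fps (crank_ones_sum z)"
proof (rule fps_ext)
  fix n
  define r where "r = (\<lambda>\<pi>. nat (crank \<pi> mod 5))"
  have z0: "z \<noteq> 0" using z by auto
  have powi: "z powi k = z ^ nat (k mod 5)" for k
  proof -
    have "k = 5 * (k div 5) + k mod 5" by simp
    hence "z powi k = (z powi 5) powi (k div 5) * z powi (k mod 5)"
      by (metis power_int_add power_int_mult z0)
    also have "z powi 5 = 1" using z by (simp add: power_int_def)
    finally show ?thesis by (simp add: power_int_def)
  qed
  have "(\<Sum>m<5. fps_const z ^ m * M_omega_gf (int m) 5) $ n = (\<Sum>m<5. z ^ m * of_nat (M_omega (int m) 5 n))"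
    by (simp add: fps_sum_nth M_omega_gf_def fps_const_power)
  also have "\<dots> = (\<Sum>m<5. \<Sum>\<pi> | \<pi> \<in> partitions_of n \<and> r \<pi> = m. of_nat (ones \<pi>) * z powi crank \<pi>)"
  proof (rule sum.cong)
    fix m :: nat assume m: "m \<in> {..<5}"
    have "[crank \<pi> = int m] (mod int 5) \<longleftrightarrow> r \<pi> = m" for \<pi>
      using m by (auto simp: cong_def r_def)
    thus "z ^ m * of_nat (M_omega (int m) 5 n) = (\<Sum>\<pi> | \<pi> \<in> partitions_of n \<and> r \<pi> = m. of_nat (ones \<pi>) * z powi crank \<pi>)"
      by (simp add: M_omega_def powi r_def sum_distrib_left mult.commute)
  qed simp
  also have "\<dots> = (\<Sum>\<pi>\<in>partitions_of n. of_nat (ones \<pi>) * z powi crank \<pi>)"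
    by (rule sum.group) (auto simp: finite_partitions_of r_def nat_less_iff)
  finally show "(\<Sum>m<5. fps_const z ^ m * M_omega_gf (int m) 5) $ n = Abs_fps (crank_ones_sum z) $ n"
    by (simp add: crank_ones_sum_def)
qed

lemma M_omega_gf_total: "(\<Sum>m<5. M_omega_gf (int m) 5) = 5 * T_ser fps_X"
proof -
  define p :: "complex fps" where "p = qpoch_inf fps_X fps_X"
  define W where "W = (\<Sum>m<5. M_omega_gf (int m) 5)"
  have W: "W = Abs_fps (crank_ones_sum 1)" using sum_M_omega_gf[of 1] by (simp add: W_def)
  have p0: "p $ 0 = 1" by (simp add: p_def qpoch_tendsto(2))
  have "p * p * W = p * (fps_X / (1 - fps_X))"
    using crank_ones_gf[of 1] lambert_1 by (simp add: p_def W)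
  hence "p * W = fps_X / (1 - fps_X)" using p0 by (auto simp: mult.assoc)
  hence 1: "fps_X = p * W * (1 - fps_X)" using fps_divide_iff[of "1 - fps_X" fps_X "p * W"] by simp
  have 2: "fps_X = T_ser fps_X * (5 * (1 - fps_X) * p)"
    unfolding T_ser_def p_def [symmetric] by (rule fps_divide_iff[THEN iffD1, OF _ refl]) (simp add: p0)
  from 1 2 have "((1 - fps_X) * p) * W = ((1 - fps_X) * p) * (5 * T_ser fps_X)"
    by (simp only: mult_ac)
  moreover have "((1 - fps_X) * p) $ 0 \<noteq> 0" by (simp add: p0)
  hence "(1 - fps_X) * p \<noteq> 0" by auto
  ultimately show ?thesis unfolding W_def by simp
qed

lemma sum_M_omega_gf_root_5:
  fixes z :: complex
  assumes z: "z ^ 5 = 1" "z \<noteq> 1"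
  defines "q \<equiv> fps_X" and "c \<equiv> fps_const z"
  shows "(\<Sum>m<5. c ^ m * M_omega_gf (int m) 5) =
    (A_ser (q ^ 5) + (c + c ^ 4 - 1) * q * B_ser (q ^ 5) + (c ^ 2 + c ^ 3) * q ^ 2 * C_ser (q ^ 5)
      - (c + c ^ 4) * q ^ 3 * D_ser (q ^ 5)) *
    (c ^ 4 * R_ser 1 q + c ^ 3 * R_ser 2 q + c ^ 2 * R_ser 3 q + c * R_ser 4 q + R_ser 5 q - S_ser q)"
    (is "?W = ?F * ?L")
proof -
  define g where "g = qpoch_inf (c * q) q * qpoch_inf (c ^ 4 * q) q"
  have z0: "z \<noteq> 0" using z by auto
  have inv: "fps_const (inverse z) = c ^ 4"
    by (simp add: inverse_root_5[OF z(1)] c_def fps_const_power)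
  have W: "?W = Abs_fps (crank_ones_sum z)"
    using sum_M_omega_gf[OF z(1)] unfolding c_def .
  have "g * ?W = qpoch_inf q q * (lambert (inverse z) - S_ser q)"
    unfolding W g_def inv [symmetric] unfolding c_def q_def by (rule crank_ones_gf[OF z0])
  also have "qpoch_inf q q = g * ?F"
    using crank_product_dissection[OF z] unfolding g_def q_def c_def .
  also have "lambert (inverse z) - S_ser q = ?L"
    using lambert_root_5[OF z(1)] unfolding q_def c_def by simp
  finally have "g * ?W = g * (?F * ?L)" by (simp only: mult.assoc)
  moreover have "g $ 0 = 1"
    unfolding g_def q_def c_def by (simp add: qpoch_tendsto(2))
  hence "g \<noteq> 0" by auto
  ultimately show ?thesis by simp
qed

text \<open>Fourier inversion with the value at 1 left open: vanishing at the nontrivial roots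
  forces the five coefficients to agree after multiplication by 5, and \<open>S\<close> is the value
  at 1. Keeping the factor 5 avoids division.\<close>

lemma root_5_inversion:
  fixes c :: "'a::idom"
  assumes c: "1 + c + c ^ 2 + c ^ 3 + c ^ 4 = 0"
    and N: "\<And>d. d \<in> {c, c ^ 2, c ^ 3, c ^ 4} \<Longrightarrow> N0 + d * N1 + d ^ 2 * N2 + d ^ 3 * N3 + d ^ 4 * N4 = 0"
  defines "S \<equiv> N0 + N1 + N2 + N3 + N4"
  shows "5 * N0 = S" "5 * N1 = S" "5 * N2 = S" "5 * N3 = S" "5 * N4 = S"
proof -
  have c5: "c ^ 5 = 1" using c by algebra
  have red: "(c ^ 2) ^ 2 = c ^ 4" "(c ^ 2) ^ 3 = c" "(c ^ 2) ^ 4 = c ^ 3"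
    "(c ^ 3) ^ 2 = c" "(c ^ 3) ^ 3 = c ^ 4" "(c ^ 3) ^ 4 = c ^ 2"
    "(c ^ 4) ^ 2 = c ^ 3" "(c ^ 4) ^ 3 = c ^ 2" "(c ^ 4) ^ 4 = c"
    by (simp_all flip: power_mult power_mod_5[OF c5, of 6] power_mod_5[OF c5, of 8]
        power_mod_5[OF c5, of 9] power_mod_5[OF c5, of 12] power_mod_5[OF c5, of 16])
  define E1 where "E1 = N0 + c * N1 + c ^ 2 * N2 + c ^ 3 * N3 + c ^ 4 * N4"
  define E2 where "E2 = N0 + c ^ 2 * N1 + c ^ 4 * N2 + c * N3 + c ^ 3 * N4"
  define E3 where "E3 = N0 + c ^ 3 * N1 + c * N2 + c ^ 4 * N3 + c ^ 2 * N4"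
  define E4 where "E4 = N0 + c ^ 4 * N1 + c ^ 3 * N2 + c ^ 2 * N3 + c * N4"
  have E: "E1 = 0" "E2 = 0" "E3 = 0" "E4 = 0"
    using N[of c] N[of "c ^ 2"] N[of "c ^ 3"] N[of "c ^ 4"]
    unfolding red E1_def E2_def E3_def E4_def by simp_all
  \<comment> \<open>The row for N_m is the sum of d^(-m) times the equation at d, over the four
    nontrivial roots d, with exponents reduced modulo 5.\<close>
  have "5 * N0 - S = E1 + E2 + E3 + E4"
    "5 * N1 - S = c ^ 4 * E1 + c ^ 3 * E2 + c ^ 2 * E3 + c * E4"
    "5 * N2 - S = c ^ 3 * E1 + c * E2 + c ^ 4 * E3 + c ^ 2 * E4"
    "5 * N3 - S = c ^ 2 * E1 + c ^ 4 * E2 + c * E3 + c ^ 3 * E4"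
    "5 * N4 - S = c * E1 + c ^ 2 * E2 + c ^ 3 * E3 + c ^ 4 * E4"
    unfolding S_def E1_def E2_def E3_def E4_def using c c5 by algebra+
  thus "5 * N0 = S" "5 * N1 = S" "5 * N2 = S" "5 * N3 = S" "5 * N4 = S"
    unfolding E by simp_all
qed

lemma primitive_root_5: obtains z :: complex where "z ^ 5 = 1" "z \<noteq> 1"
proof
  have "cis (2 * pi / 5) ^ 5 = cis (real 5 * (2 * pi / 5))" by (rule Complex.DeMoivre)
  thus "cis (2 * pi / 5) ^ 5 = 1" by simp
  have "sin (2 * pi / 5) > 0" by (intro sin_gt_zero) auto
  thus "cis (2 * pi / 5) \<noteq> 1" by (auto simp: complex_eq_iff)
qed

theorem theorem3p1:
  fixes q R1 R2 R3 R4 R5 S T :: "complex fps"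
  defines "q \<equiv> fps_X"
    and "R1 \<equiv> R_ser 1 q" and "R2 \<equiv> R_ser 2 q" and "R3 \<equiv> R_ser 3 q"
    and "R4 \<equiv> R_ser 4 q" and "R5 \<equiv> R_ser 5 q"
    and "S \<equiv> S_ser q" and "T \<equiv> T_ser q"
  shows
    "M_omega_gf 0 5 =
         q^3 / 5 * D_ser (q^5) * (- 3 * R1 + 2 * R2 + 2 * R3 - 3 * R4 + 2 * R5 - 2 * S)
       + q^2 / 5 * C_ser (q^5) * (- 2 * R1 + 3 * R2 + 3 * R3 - 2 * R4 - 2 * R5 + 2 * S)
       + q / 5 * B_ser (q^5) * (4 * R1 - R2 - R3 + 4 * R4 - 6 * R5 + 6 * S)
       + 1 / 5 * A_ser (q^5) * (- R1 - R2 - R3 - R4 + 4 * R5 - 4 * S)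
       + T \<and>
     M_omega_gf 1 5 =
         q^3 / 5 * D_ser (q^5) * (2 * R1 + 2 * R2 - 3 * R3 + 2 * R4 - 3 * R5 + 3 * S)
       + q^2 / 5 * C_ser (q^5) * (3 * R1 + 3 * R2 - 2 * R3 - 2 * R4 - 2 * R5 + 2 * S)
       + q / 5 * B_ser (q^5) * (- R1 - R2 + 4 * R3 - 6 * R4 + 4 * R5 - 4 * S)
       + 1 / 5 * A_ser (q^5) * (- R1 - R2 - R3 + 4 * R4 - R5 + S)
       + T \<and>
     M_omega_gf 2 5 =
         q^3 / 5 * D_ser (q^5) * (2 * R1 - 3 * R2 + 2 * R3 - 3 * R4 + 2 * R5 - 2 * S)
       + q^2 / 5 * C_ser (q^5) * (3 * R1 - 2 * R2 - 2 * R3 - 2 * R4 + 3 * R5 - 3 * S)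
       + q / 5 * B_ser (q^5) * (- R1 + 4 * R2 - 6 * R3 + 4 * R4 - R5 + S)
       + 1 / 5 * A_ser (q^5) * (- R1 - R2 + 4 * R3 - R4 - R5 + S)
       + T \<and>
     M_omega_gf 3 5 =
         q^3 / 5 * D_ser (q^5) * (- 3 * R1 + 2 * R2 - 3 * R3 + 2 * R4 + 2 * R5 - 2 * S)
       + q^2 / 5 * C_ser (q^5) * (- 2 * R1 - 2 * R2 - 2 * R3 + 3 * R4 + 3 * R5 - 3 * S)
       + q / 5 * B_ser (q^5) * (4 * R1 - 6 * R2 + 4 * R3 - R4 - R5 + S)
       + 1 / 5 * A_ser (q^5) * (- R1 + 4 * R2 - R3 - R4 - R5 + S)
       + T \<and>
     M_omega_gf 4 5 =
         q^3 / 5 * D_ser (q^5) * (2 * R1 - 3 * R2 + 2 * R3 + 2 * R4 - 3 * R5 + 3 * S)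
       + q^2 / 5 * C_ser (q^5) * (- 2 * R1 - 2 * R2 + 3 * R3 + 3 * R4 - 2 * R5 + 2 * S)
       + q / 5 * B_ser (q^5) * (- 6 * R1 + 4 * R2 - R3 - R4 + 4 * R5 - 4 * S)
       + 1 / 5 * A_ser (q^5) * (4 * R1 - R2 - R3 - R4 - R5 + S)
       + T"
proof -
  obtain z :: complex where z: "z ^ 5 = 1" "z \<noteq> 1" by (rule primitive_root_5)
  define c where "c = fps_const z"
  have "fps_const (1 + z + z ^ 2 + z ^ 3 + z ^ 4) = 0"
    using sum_powers_root_5[OF z] by simp
  hence c: "1 + c + c ^ 2 + c ^ 3 + c ^ 4 = 0"
    by (simp add: c_def fps_const_power flip: fps_const_add)
  define A where "A = A_ser (q ^ 5)"
  define B where "B = B_ser (q ^ 5)"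
  define C where "C = C_ser (q ^ 5)"
  define D where "D = D_ser (q ^ 5)"
  define M where "M = (\<lambda>m. M_omega_gf m 5)"
  \<comment> \<open>\<open>a0\<close>, \<open>a1\<close>, \<open>a2\<close> are the coefficients of
    1, d + d^4 and d^2 + d^3 in the dissected product.\<close>
  define a0 where "a0 = A - q * B"
  define a1 where "a1 = q * B - q ^ 3 * D"
  define a2 where "a2 = q ^ 2 * C"
  define b0 where "b0 = R5 - S"
  \<comment> \<open>\<open>V0\<close> to \<open>V4\<close> form the cyclic convolution modulo 5 of
    (a0, a1, a2, a2, a1) with (b0, R4, R3, R2, R1): V_m collects the coefficient of d^m under d^5 =
    1.\<close>
  define V0 where "V0 = a0 * b0 + a1 * (R1 + R4) + a2 * (R2 + R3)"
  define V1 where "V1 = a0 * R4 + a1 * (b0 + R3) + a2 * (R1 + R2)"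
  define V2 where "V2 = a0 * R3 + a1 * (R4 + R2) + a2 * (b0 + R1)"
  define V3 where "V3 = a0 * R2 + a1 * (R3 + R1) + a2 * (R4 + b0)"
  define V4 where "V4 = a0 * R1 + a1 * (R2 + b0) + a2 * (R3 + R4)"
  have root: "(M 0 - V0) + d * (M 1 - V1) + d ^ 2 * (M 2 - V2) + d ^ 3 * (M 3 - V3) + d ^ 4 * (M 4 - V4) = 0"
    if "d \<in> {c, c ^ 2, c ^ 3, c ^ 4}" for d
  proof -
    have "\<exists>k\<in>{1, 2, 3, 4 :: nat}. d = c ^ k" using that by simp
    then obtain k where k: "k \<in> {1, 2, 3, 4 :: nat}" "d = c ^ k" by blast
    define w where "w = z ^ k"
    have d: "d = fps_const w" by (simp add: k w_def c_def fps_const_power)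
    have w5: "w ^ 5 = 1" unfolding w_def using z(1) by (metis mult.commute power_mult power_one)
    have w1: "w \<noteq> 1"
    proof
      assume "w = 1"
      \<comment> \<open>The exponents 1, 3, 2, 4 are the inverses of k = 1, 2, 3, 4 modulo
        5.\<close>
      moreover have "z = w ^ (if k = 1 then 1 else if k = 2 then 3 else if k = 3 then 2 else 4)"
        using power_mod_5[OF z(1), of 6] power_mod_5[OF z(1), of 16] k(1)
        by (auto simp: w_def simp flip: power_mult split: if_splits)
      ultimately show False using z(2) by simp
    qed
    have d5: "d ^ 5 = 1" using w5 by (simp add: d fps_const_power)
    have "M 0 + d * M 1 + d ^ 2 * M 2 + d ^ 3 * M 3 + d ^ 4 * M 4 = (\<Sum>m<5. d ^ m * M_omega_gf (int m) 5)"
      by (simp add: M_def numeral_eq_Suc lessThan_Suc add_ac)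
    also have "\<dots> = (A + (d + d ^ 4 - 1) * q * B + (d ^ 2 + d ^ 3) * q ^ 2 * C - (d + d ^ 4) * q ^ 3 * D) *
      (d ^ 4 * R1 + d ^ 3 * R2 + d ^ 2 * R3 + d * R4 + R5 - S)"
      unfolding d A_def B_def C_def D_def R1_def R2_def R3_def R4_def R5_def S_def q_def
      by (rule sum_M_omega_gf_root_5[OF w5 w1])
    also have "\<dots> = (a0 + (d + d ^ 4) * a1 + (d ^ 2 + d ^ 3) * a2) * (b0 + d * R4 + d ^ 2 * R3 + d ^ 3 * R2 + d ^ 4 * R1)"
      unfolding a0_def a1_def a2_def b0_def by algebra
    also have "\<dots> = V0 + d * V1 + d ^ 2 * V2 + d ^ 3 * V3 + d ^ 4 * V4"
      unfolding V0_def V1_def V2_def V3_def V4_def using d5 by algebra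
    finally show ?thesis by (simp add: algebra_simps)
  qed
  have M: "M_omega_gf m 5 = M m" for m by (simp add: M_def)
  have total: "M 0 + M 1 + M 2 + M 3 + M 4 = 5 * T"
    using M_omega_gf_total by (simp add: M_def T_def q_def numeral_eq_Suc lessThan_Suc add_ac)
  define i :: "complex fps" where "i = inverse 5"
  have i: "i * 5 = 1" unfolding i_def by (rule inverse_mult_eq_1) simp
  have div5: "x / 5 = x * i" for x unfolding i_def by (rule fps_divide_unit) simp
  have fifthI: "m = x / 5 * D * e1 + y / 5 * C * e2 + w / 5 * B * e3 + 1 / 5 * A * e4 + T"
    if "5 * m = x * D * e1 + y * C * e2 + w * B * e3 + A * e4 + 5 * T" for m x y w e1 e2 e3 e4
    unfolding div5 using that i by algebra
  note inv = root_5_inversion[OF c root]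
  \<comment> \<open>Here a0 + 2 a1 + 2 a2 = A + q B + 2 q^2 C - 2 q^3 D. Subtracting this total from
    5 V_m gives the stated constants: 4, -1 with A; 4, -1, -6 with B; 3, -2 with C; 2, -3 with
    D.\<close>
  have V: "V0 + V1 + V2 + V3 + V4 = (a0 + 2 * a1 + 2 * a2) * (b0 + R1 + R2 + R3 + R4)"
    unfolding V0_def V1_def V2_def V3_def V4_def by (simp add: algebra_simps)
  \<comment> \<open>The common value of 5 (M_m - V_m) is the sum of all five differences, which is 5
    T minus the total of the V_m.\<close>
  have M5: "5 * M 0 = 5 * V0 + 5 * T - (V0 + V1 + V2 + V3 + V4)"
    "5 * M 1 = 5 * V1 + 5 * T - (V0 + V1 + V2 + V3 + V4)"
    "5 * M 2 = 5 * V2 + 5 * T - (V0 + V1 + V2 + V3 + V4)"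
    "5 * M 3 = 5 * V3 + 5 * T - (V0 + V1 + V2 + V3 + V4)"
    "5 * M 4 = 5 * V4 + 5 * T - (V0 + V1 + V2 + V3 + V4)"
    using inv total by algebra+
  show ?thesis
    unfolding M A_def [symmetric] B_def [symmetric] C_def [symmetric] D_def [symmetric]
    by (intro conjI fifthI; unfold M5 V, unfold V0_def V1_def V2_def V3_def V4_def a0_def a1_def a2_def b0_def)
       (simp_all add: algebra_simps)
qed

end
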